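(* Let $(L=S\times\mathbb{R},g_L)$ be a standard stationary spacetime with Fermat metric $F$ on $S$, and let $D$ be a domain of class $C^{2}$ of $S$. Then $(\partial D;F)$ is infinitesimally convex (resp. strongly convex) if and only if $(\partial D\times\mathbb{R};g_L)$ is infinitesimally light-convex (resp. strongly light-convex).
   Context: Standard stationary spacetime: $L=S\times\mathbb{R}$ with $g_L\big((y,\tau),(y,\tau)\big)=g_0(y,y)+2\omega_0(y)\tau-\beta(x)\tau^2$ for $(y,\tau)\in T_xS\times\mathbb{R}$, where $g_0$ is a Riemannian metric, $\omega_0$ a one-form and $\beta>0$ a function on $S$; it is time-oriented so that $\partial_t$ is future-pointing. Fermat metric: $F=\sqrt{h}+\omega$ on $S$, with $h(y,y)=\frac{1}{\beta^2}\omega_0(y)^2+\frac1\beta g_0(y,y)$ and $\omega=\frac1\beta\omega_0$; it is a Finsler metric of Randers type. A domain is an open connected subset; class $C^2$ means its closure is a manifold with boundary and $\partial D$ is $C^2$. Let $\phi$ be a $C^2$ function (near each boundary point, or global) with $\phi=0$ exactly on $\partial D$, $\phi>0$ on $D$, and $\mathrm{d}\phi\ne0$ on $\partial D$. $(\partial D;F)$ is infinitesimally (resp. strongly) convex if $(H_\phi)_y(y,y)\le0$ (resp. $<0$) for every $x\in\partial D$ and $y\in T_x\partial D\setminus\{0\}$, where $H_\phi$ is the Hessian for the Chern connection of $F$, so $(H_\phi)_y(y,y)=(\phi\circ\gamma)''(0)$ for the constant-speed $F$-geodesic $\gamma$ with $\dot\gamma(0)=y$. With $\Phi(x,t)=\phi(x)$,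 $(\partial D\times\mathbb{R};g_L)$ is infinitesimally (resp. strongly) light-convex if $H^{g_L}_\Phi\big((y,\tau),(y,\tau)\big)\le0$ (resp. $<0$) for every $(x,t)\in\partial D\times\mathbb{R}$ and every lightlike (nonzero null) $(y,\tau)\in T_x\partial D\times\mathbb{R}$, where $H^{g_L}_\Phi$ is the Hessian of $\Phi$ for the Levi-Civita connection of $g_L$. *)

theory Defs
  imports "HOL-Analysis.Analysis"
begin

section \<open>Differentiability of finite order on open sets\<close>

abbreviation dir_deriv ::
  "('a::real_normed_vector \<Rightarrow> 'b::real_normed_vector) \<Rightarrow> 'a \<Rightarrow> 'a \<Rightarrow> 'b" where
  "dir_deriv f p u \<equiv> frechet_derivative f (at p) u"

primrec Ck_on ::
  "nat \<Rightarrow> 'a::real_normed_vector set \<Rightarrow> ('a \<Rightarrow> 'b::real_normed_vector) \<Rightarrow> bool" where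
  "Ck_on 0 U f \<longleftrightarrow> continuous_on U f"
| "Ck_on (Suc k) U f \<longleftrightarrow>
     (\<forall>p\<in>U. f differentiable (at p)) \<and> (\<forall>u. Ck_on k U (\<lambda>p. dir_deriv f p u))"

abbreviation smooth_on ::
  "'a::real_normed_vector set \<Rightarrow> ('a \<Rightarrow> 'b::real_normed_vector) \<Rightarrow> bool" where
  "smooth_on U f \<equiv> (\<forall>k. Ck_on k U f)"


section \<open>Smooth manifolds\<close>

text \<open>
  A manifold is a Hausdorff, second countable type of points together with a smooth atlas
  (not assumed maximal) whose charts take values in a Euclidean space; a chart is its domain
  paired with its coordinate map.
\<close>

type_synonym ('a, 'e) chart = "'a set \<times> ('a \<Rightarrow> 'e)"

definition chart_image :: "('a, 'e) chart \<Rightarrow> 'e set" where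
  "chart_image c = snd c ` fst c"

definition chart_inv :: "('a, 'e) chart \<Rightarrow> 'e \<Rightarrow> 'a" where
  "chart_inv c = inv_into (fst c) (snd c)"

definition is_chart :: "('a::topological_space, 'e::euclidean_space) chart \<Rightarrow> bool" where
  "is_chart c \<longleftrightarrow> open (fst c) \<and> open (chart_image c) \<and>
     homeomorphism (fst c) (chart_image c) (snd c) (chart_inv c)"

definition Ck_transition ::
  "nat \<Rightarrow> ('a, 'e::euclidean_space) chart \<Rightarrow> ('a, 'e) chart \<Rightarrow> bool" where
  "Ck_transition k c d \<longleftrightarrow> Ck_on k (snd c ` (fst c \<inter> fst d)) (snd d \<circ> chart_inv c)"

definition smooth_atlas ::
  "('a::topological_space, 'e::euclidean_space) chart set \<Rightarrow> bool" where
  "smooth_atlas A \<longleftrightarrow> (\<forall>c\<in>A. is_chart c) \<and> (\<Union>c\<in>A. fst c) = UNIV \<and>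
     (\<forall>c\<in>A. \<forall>d\<in>A. \<forall>k. Ck_transition k c d)"

definition charts_at :: "('a, 'e) chart set \<Rightarrow> 'a \<Rightarrow> ('a, 'e) chart set" where
  "charts_at A x = {c\<in>A. x \<in> fst c}"

definition Ck_function ::
  "('a, 'e::euclidean_space) chart set \<Rightarrow> nat \<Rightarrow> 'a set \<Rightarrow> ('a \<Rightarrow> real) \<Rightarrow> bool" where
  "Ck_function A k U f \<longleftrightarrow> (\<forall>c\<in>A. Ck_on k (snd c ` (fst c \<inter> U)) (f \<circ> chart_inv c))"

text \<open>
  A tangent vector at \<open>x\<close> is the family of its components in all charts around \<open>x\<close>, related by
  the differentials of the coordinate changes; it is set to \<open>0\<close> on all other charts, so that two
  tangent vectors at \<open>x\<close> are equal iff their components agree.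
\<close>

type_synonym ('a, 'e) tangent = "('a, 'e) chart \<Rightarrow> 'e"

definition tangent_space ::
  "('a, 'e::euclidean_space) chart set \<Rightarrow> 'a \<Rightarrow> ('a, 'e) tangent set" where
  "tangent_space A x = {v.
     (\<forall>c\<in>charts_at A x. \<forall>d\<in>charts_at A x. v d = dir_deriv (snd d \<circ> chart_inv c) (snd c x) (v c)) \<and>
     (\<forall>c. c \<notin> charts_at A x \<longrightarrow> v c = 0)}"

abbreviation zero_tangent :: "('a, 'e::euclidean_space) tangent" where
  "zero_tangent \<equiv> (\<lambda>_. 0)"

text \<open>The tangent vector at \<open>x\<close> whose components in the chart \<open>c\<close> are \<open>u\<close>.\<close>

definition tangent_of ::
  "('a, 'e::euclidean_space) chart set \<Rightarrow> ('a, 'e) chart \<Rightarrow> 'a \<Rightarrow> 'e \<Rightarrow> ('a, 'e) tangent" where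
  "tangent_of A c x u =
     (\<lambda>d. if d \<in> charts_at A x then dir_deriv (snd d \<circ> chart_inv c) (snd c x) u else 0)"


section \<open>Metrics, one-forms and functions in coordinates\<close>

type_synonym ('a, 'e) metric = "'a \<Rightarrow> ('a, 'e) tangent \<Rightarrow> ('a, 'e) tangent \<Rightarrow> real"

text \<open>One-forms and Finsler metrics are both functions of a point and a tangent vector there.\<close>

type_synonym ('a, 'e) tangent_fun = "'a \<Rightarrow> ('a, 'e) tangent \<Rightarrow> real"

definition metric_coord ::
  "('a, 'e::euclidean_space) chart set \<Rightarrow> ('a, 'e) metric \<Rightarrow> ('a, 'e) chart \<Rightarrow>
   'e \<Rightarrow> 'e \<Rightarrow> 'e \<Rightarrow> real" where
  "metric_coord A g c p u v =
     (let x = chart_inv c p in g x (tangent_of A c x u) (tangent_of A c x v))"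

definition tangent_fun_coord ::
  "('a, 'e::euclidean_space) chart set \<Rightarrow> ('a, 'e) tangent_fun \<Rightarrow> ('a, 'e) chart \<Rightarrow>
   'e \<Rightarrow> 'e \<Rightarrow> real" where
  "tangent_fun_coord A w c p u = (let x = chart_inv c p in w x (tangent_of A c x u))"

definition riemannian_metric ::
  "('a, 'e::euclidean_space) chart set \<Rightarrow> ('a, 'e) metric \<Rightarrow> bool" where
  "riemannian_metric A g \<longleftrightarrow> (\<forall>c\<in>A.
     (\<forall>p\<in>chart_image c.
        bilinear (metric_coord A g c p) \<and>
        (\<forall>u v. metric_coord A g c p u v = metric_coord A g c p v u) \<and>
        (\<forall>u. u \<noteq> 0 \<longrightarrow> metric_coord A g c p u u > 0)) \<and>
     (\<forall>u v. smooth_on (chart_image c) (\<lambda>p. metric_coord A g c p u v)))"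

definition smooth_one_form ::
  "('a, 'e::euclidean_space) chart set \<Rightarrow> ('a, 'e) tangent_fun \<Rightarrow> bool" where
  "smooth_one_form A w \<longleftrightarrow> (\<forall>c\<in>A.
     (\<forall>p\<in>chart_image c. linear (tangent_fun_coord A w c p)) \<and>
     (\<forall>u. smooth_on (chart_image c) (\<lambda>p. tangent_fun_coord A w c p u)))"


section \<open>Standard stationary spacetimes and their Fermat metrics\<close>

definition stationary_data ::
  "('a::topological_space, 'e::euclidean_space) chart set \<Rightarrow>
   ('a, 'e) metric \<Rightarrow> ('a, 'e) tangent_fun \<Rightarrow> ('a \<Rightarrow> real) \<Rightarrow> bool" where
  "stationary_data A g0 w0 b \<longleftrightarrow> smooth_atlas A \<and> riemannian_metric A g0 \<and>
     smooth_one_form A w0 \<and> (\<forall>k. Ck_function A k UNIV b) \<and> (\<forall>x. b x > 0)"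

text \<open>
  The tangent space of \<open>S \<times> \<real>\<close> at \<open>(x, t)\<close> is \<open>T\<^sub>xS \<times> \<real>\<close>. The symmetric bilinear form below
  is the polarisation of \<open>g\<^sub>0(y,y) + 2 \<omega>\<^sub>0(y) \<tau> - \<beta>(x) \<tau>\<^sup>2\<close>.
\<close>

type_synonym ('a, 'e) stationary_metric =
  "'a \<times> real \<Rightarrow> ('a, 'e) tangent \<times> real \<Rightarrow> ('a, 'e) tangent \<times> real \<Rightarrow> real"

definition stationary_metric ::
  "('a, 'e) metric \<Rightarrow> ('a, 'e) tangent_fun \<Rightarrow> ('a \<Rightarrow> real) \<Rightarrow> ('a, 'e) stationary_metric" where
  "stationary_metric g0 w0 b = (\<lambda>(x, t) (y, \<tau>) (z, \<sigma>).
     g0 x y z + w0 x y * \<sigma> + w0 x z * \<tau> - b x * \<tau> * \<sigma>)"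

definition fermat_metric ::
  "('a, 'e) metric \<Rightarrow> ('a, 'e) tangent_fun \<Rightarrow> ('a \<Rightarrow> real) \<Rightarrow> ('a, 'e) tangent_fun" where
  "fermat_metric g0 w0 b x y =
     sqrt ((w0 x y)\<^sup>2 / (b x)\<^sup>2 + g0 x y y / b x) + w0 x y / b x"


section \<open>Connections and Hessians in coordinates\<close>

text \<open>The vector dual to the linear form \<open>l\<close> under the nondegenerate bilinear form \<open>B\<close>.\<close>

definition raise_form :: "('e \<Rightarrow> 'e \<Rightarrow> real) \<Rightarrow> ('e \<Rightarrow> real) \<Rightarrow> 'e" where
  "raise_form B l = (THE a. \<forall>w. B a w = l w)"

text \<open>
  \<open>christoffel g p u v\<close> is the vector with components \<open>\<Gamma>\<^sup>k\<^sub>i\<^sub>j u\<^sup>i v\<^sup>j\<close>, where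
  \<open>\<Gamma>\<^sup>k\<^sub>i\<^sub>j\<close> are the Christoffel symbols of the second kind.
\<close>

definition christoffel ::
  "('e::euclidean_space \<Rightarrow> 'e \<Rightarrow> 'e \<Rightarrow> real) \<Rightarrow> 'e \<Rightarrow> 'e \<Rightarrow> 'e \<Rightarrow> 'e" where
  "christoffel g p u v = raise_form (g p) (\<lambda>w.
     (dir_deriv (\<lambda>q. g q v w) p u + dir_deriv (\<lambda>q. g q u w) p v
        - dir_deriv (\<lambda>q. g q u v) p w) / 2)"

text \<open>
  Second covariant derivative in the directions \<open>u\<close>, \<open>v\<close>, where \<open>G u v\<close> stands for the
  contraction of the connection coefficients with \<open>u\<close> and \<open>v\<close>.
\<close>

definition covariant_hessian ::
  "('e::euclidean_space \<Rightarrow> real) \<Rightarrow> ('e \<Rightarrow> 'e \<Rightarrow> 'e) \<Rightarrow> 'e \<Rightarrow> 'e \<Rightarrow> 'e \<Rightarrow> real" where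
  "covariant_hessian f G p u v =
     dir_deriv (\<lambda>q. dir_deriv f q v) p u - dir_deriv f p (G u v)"

text \<open>
  For a Finsler metric \<open>F\<close> in coordinates, \<open>p\<close> is the position and \<open>y \<noteq> 0\<close> the reference
  vector. \<open>fundamental_tensor\<close> is \<open>g\<^sub>i\<^sub>j = 1/2 \<partial>\<^sup>2F\<^sup>2/\<partial>y\<^sup>i\<partial>y\<^sup>j\<close> and \<open>cartan_tensor\<close> is
  \<open>C\<^sub>i\<^sub>j\<^sub>k = 1/2 \<partial>g\<^sub>j\<^sub>k/\<partial>y\<^sup>i\<close> (no factor \<open>F\<close>).
\<close>

definition fundamental_tensor ::
  "('e::euclidean_space \<Rightarrow> 'e \<Rightarrow> real) \<Rightarrow> 'e \<Rightarrow> 'e \<Rightarrow> 'e \<Rightarrow> 'e \<Rightarrow> real" where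
  "fundamental_tensor F p y u v =
     dir_deriv (\<lambda>z. dir_deriv (\<lambda>z'. (F p z')\<^sup>2) z v) y u / 2"

definition cartan_tensor ::
  "('e::euclidean_space \<Rightarrow> 'e \<Rightarrow> real) \<Rightarrow> 'e \<Rightarrow> 'e \<Rightarrow> 'e \<Rightarrow> 'e \<Rightarrow> 'e \<Rightarrow> real" where
  "cartan_tensor F p y u v w = dir_deriv (\<lambda>z. fundamental_tensor F p z v w) y u / 2"

text \<open>
  The formal Christoffel symbols \<open>\<gamma>\<^sup>k\<^sub>i\<^sub>j(p, y)\<close> and the nonlinear connection
  \<open>N\<^sup>i\<^sub>j = \<gamma>\<^sup>i\<^sub>j\<^sub>k y\<^sup>k - C\<^sup>i\<^sub>j\<^sub>k \<gamma>\<^sup>k\<^sub>r\<^sub>s y\<^sup>r y\<^sup>s\<close>.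
\<close>

definition formal_christoffel ::
  "('e::euclidean_space \<Rightarrow> 'e \<Rightarrow> real) \<Rightarrow> 'e \<Rightarrow> 'e \<Rightarrow> 'e \<Rightarrow> 'e \<Rightarrow> 'e" where
  "formal_christoffel F p y u v = christoffel (\<lambda>q. fundamental_tensor F q y) p u v"

definition nonlinear_connection ::
  "('e::euclidean_space \<Rightarrow> 'e \<Rightarrow> real) \<Rightarrow> 'e \<Rightarrow> 'e \<Rightarrow> 'e \<Rightarrow> 'e" where
  "nonlinear_connection F p y u = formal_christoffel F p y u y -
     raise_form (fundamental_tensor F p y)
       (cartan_tensor F p y u (formal_christoffel F p y y y))"

text \<open>
  The derivative \<open>\<delta>/\<delta>x\<^sup>j = \<partial>/\<partial>x\<^sup>j - N\<^sup>i\<^sub>j \<partial>/\<partial>y\<^sup>i\<close>, and the Chern connection coefficients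
  \<open>\<Gamma>\<^sup>i\<^sub>j\<^sub>k = 1/2 g\<^sup>i\<^sup>l (\<delta>g\<^sub>l\<^sub>k/\<delta>x\<^sup>j + \<delta>g\<^sub>l\<^sub>j/\<delta>x\<^sup>k - \<delta>g\<^sub>j\<^sub>k/\<delta>x\<^sup>l)\<close>.
\<close>

definition horizontal_deriv ::
  "('e::euclidean_space \<Rightarrow> 'e \<Rightarrow> real) \<Rightarrow> ('e \<Rightarrow> 'e \<Rightarrow> real) \<Rightarrow> 'e \<Rightarrow> 'e \<Rightarrow> 'e \<Rightarrow> real" where
  "horizontal_deriv F f p y u =
     dir_deriv (\<lambda>q. f q y) p u - dir_deriv (\<lambda>z. f p z) y (nonlinear_connection F p y u)"

definition chern_connection ::
  "('e::euclidean_space \<Rightarrow> 'e \<Rightarrow> real) \<Rightarrow> 'e \<Rightarrow> 'e \<Rightarrow> 'e \<Rightarrow> 'e \<Rightarrow> 'e" where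
  "chern_connection F p y u v = raise_form (fundamental_tensor F p y) (\<lambda>w.
     (horizontal_deriv F (\<lambda>q z. fundamental_tensor F q z v w) p y u
      + horizontal_deriv F (\<lambda>q z. fundamental_tensor F q z u w) p y v
      - horizontal_deriv F (\<lambda>q z. fundamental_tensor F q z u v) p y w) / 2)"

text \<open>
  \<open>(H\<^sub>f)\<^sub>y(u, v)\<close> at \<open>x\<close>, evaluated in the chart \<open>c\<close> around \<open>x\<close>. The value does not depend on
  \<open>c\<close>; the convexity conditions below are required in every chart.
\<close>

definition finsler_hessian ::
  "('a, 'e::euclidean_space) chart set \<Rightarrow> ('a, 'e) tangent_fun \<Rightarrow> ('a \<Rightarrow> real) \<Rightarrow>
   ('a, 'e) chart \<Rightarrow> 'a \<Rightarrow> ('a, 'e) tangent \<Rightarrow> ('a, 'e) tangent \<Rightarrow> ('a, 'e) tangent \<Rightarrow> real" where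
  "finsler_hessian A F f c x y u v =
     covariant_hessian (f \<circ> chart_inv c)
       (chern_connection (tangent_fun_coord A F c) (snd c x) (y c)) (snd c x) (u c) (v c)"

text \<open>
  On \<open>S \<times> \<real>\<close> the charts are the products of the charts of \<open>S\<close> with the identity of \<open>\<real>\<close>; the
  components of \<open>(y, \<tau>)\<close> in such a chart are \<open>(y c, \<tau>)\<close>.
\<close>

definition stationary_metric_coord ::
  "('a, 'e::euclidean_space) chart set \<Rightarrow> ('a, 'e) stationary_metric \<Rightarrow> ('a, 'e) chart \<Rightarrow>
   'e \<times> real \<Rightarrow> 'e \<times> real \<Rightarrow> 'e \<times> real \<Rightarrow> real" where
  "stationary_metric_coord A g c = (\<lambda>(p, t) (u, \<tau>) (v, \<sigma>).
     let x = chart_inv c p in g (x, t) (tangent_of A c x u, \<tau>) (tangent_of A c x v, \<sigma>))"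

definition levi_civita_hessian ::
  "('a, 'e::euclidean_space) chart set \<Rightarrow> ('a, 'e) stationary_metric \<Rightarrow> ('a \<times> real \<Rightarrow> real) \<Rightarrow>
   ('a, 'e) chart \<Rightarrow> 'a \<times> real \<Rightarrow> ('a, 'e) tangent \<times> real \<Rightarrow> ('a, 'e) tangent \<times> real \<Rightarrow> real" where
  "levi_civita_hessian A g f c = (\<lambda>(x, t) (y, \<tau>) (z, \<sigma>).
     covariant_hessian (\<lambda>(p, s). f (chart_inv c p, s))
       (christoffel (stationary_metric_coord A g c) (snd c x, t)) (snd c x, t) (y c, \<tau>) (z c, \<sigma>))"


section \<open>Domains of class \<open>C\<^sup>2\<close>\<close>

text \<open>
  The closure of a domain is a \<open>C\<^sup>2\<close> manifold with boundary \<open>frontier D\<close>: around each frontier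
  point there is a chart \<open>d\<close>, \<open>C\<^sup>2\<close>-compatible with the atlas, in which the closure is a closed
  half space and the frontier is its bounding hyperplane.
\<close>

definition C2_domain ::
  "('a::topological_space, 'e::euclidean_space) chart set \<Rightarrow> 'a set \<Rightarrow> bool" where
  "C2_domain A D \<longleftrightarrow> open D \<and> connected D \<and>
     (\<forall>x\<in>frontier D. \<exists>d e. is_chart d \<and> x \<in> fst d \<and> e \<noteq> 0 \<and>
        (\<forall>c\<in>A. Ck_transition 2 c d \<and> Ck_transition 2 d c) \<and>
        closure D \<inter> fst d = {q\<in>fst d. snd d q \<bullet> e \<ge> 0} \<and>
        frontier D \<inter> fst d = {q\<in>fst d. snd d q \<bullet> e = 0})"

definition defining_function_near ::
  "('a::topological_space, 'e::euclidean_space) chart set \<Rightarrow> 'a set \<Rightarrow> 'a \<Rightarrow> ('a \<Rightarrow> real) \<Rightarrow> bool" where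
  "defining_function_near A D x f \<longleftrightarrow> (\<exists>U. open U \<and> x \<in> U \<and> Ck_function A 2 U f \<and>
     (\<forall>q\<in>U. f q = 0 \<longleftrightarrow> q \<in> frontier D) \<and> (\<forall>q\<in>U \<inter> D. f q > 0) \<and>
     (\<forall>q\<in>U \<inter> frontier D. \<forall>c\<in>charts_at A q.
        frechet_derivative (f \<circ> chart_inv c) (at (snd c q)) \<noteq> (\<lambda>_. 0)))"

text \<open>The tangent space \<open>T\<^sub>x\<partial>D\<close>: velocities of \<open>C\<^sup>1\<close> curves through \<open>x\<close> lying in \<open>\<partial>D\<close>.\<close>

definition boundary_tangent_space ::
  "('a::topological_space, 'e::euclidean_space) chart set \<Rightarrow> 'a set \<Rightarrow> 'a \<Rightarrow> ('a, 'e) tangent set" where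
  "boundary_tangent_space A D x = {y\<in>tangent_space A x.
     \<exists>c\<in>charts_at A x. \<exists>\<gamma> \<epsilon>. \<epsilon> > (0::real) \<and> \<gamma> 0 = x \<and>
       \<gamma> ` {-\<epsilon><..<\<epsilon>} \<subseteq> frontier D \<inter> fst c \<and>
       (snd c \<circ> \<gamma>) C1_differentiable_on {-\<epsilon><..<\<epsilon>} \<and>
       ((snd c \<circ> \<gamma>) has_vector_derivative y c) (at 0)}"


section \<open>Convexity of the boundary\<close>

text \<open>
  \<open>\<phi> x\<close> is the function used near the boundary point \<open>x\<close>; a global defining function is the case
  where \<open>\<phi>\<close> is constant in its first argument.
\<close>

definition infinitesimally_convex ::
  "('a::topological_space, 'e::euclidean_space) chart set \<Rightarrow> 'a set \<Rightarrow> ('a, 'e) tangent_fun \<Rightarrow>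
   ('a \<Rightarrow> 'a \<Rightarrow> real) \<Rightarrow> bool" where
  "infinitesimally_convex A D F \<phi> \<longleftrightarrow>
     (\<forall>x\<in>frontier D. \<forall>y\<in>boundary_tangent_space A D x - {zero_tangent}. \<forall>c\<in>charts_at A x.
        finsler_hessian A F (\<phi> x) c x y y y \<le> 0)"

definition strongly_convex ::
  "('a::topological_space, 'e::euclidean_space) chart set \<Rightarrow> 'a set \<Rightarrow> ('a, 'e) tangent_fun \<Rightarrow>
   ('a \<Rightarrow> 'a \<Rightarrow> real) \<Rightarrow> bool" where
  "strongly_convex A D F \<phi> \<longleftrightarrow>
     (\<forall>x\<in>frontier D. \<forall>y\<in>boundary_tangent_space A D x - {zero_tangent}. \<forall>c\<in>charts_at A x.
        finsler_hessian A F (\<phi> x) c x y y y < 0)"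

definition lightlike ::
  "('a, 'e::euclidean_space) stationary_metric \<Rightarrow> 'a \<times> real \<Rightarrow> ('a, 'e) tangent \<times> real \<Rightarrow> bool" where
  "lightlike g z v \<longleftrightarrow> v \<noteq> (zero_tangent, 0) \<and> g z v v = 0"

definition infinitesimally_light_convex ::
  "('a::topological_space, 'e::euclidean_space) chart set \<Rightarrow> 'a set \<Rightarrow> ('a, 'e) stationary_metric \<Rightarrow>
   ('a \<Rightarrow> 'a \<Rightarrow> real) \<Rightarrow> bool" where
  "infinitesimally_light_convex A D g \<phi> \<longleftrightarrow>
     (\<forall>x\<in>frontier D. \<forall>t. \<forall>v\<in>boundary_tangent_space A D x \<times> UNIV. lightlike g (x, t) v \<longrightarrow>
        (\<forall>c\<in>charts_at A x. levi_civita_hessian A g (\<lambda>(q, s). \<phi> x q) c (x, t) v v \<le> 0))"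

definition strongly_light_convex ::
  "('a::topological_space, 'e::euclidean_space) chart set \<Rightarrow> 'a set \<Rightarrow> ('a, 'e) stationary_metric \<Rightarrow>
   ('a \<Rightarrow> 'a \<Rightarrow> real) \<Rightarrow> bool" where
  "strongly_light_convex A D g \<phi> \<longleftrightarrow>
     (\<forall>x\<in>frontier D. \<forall>t. \<forall>v\<in>boundary_tangent_space A D x \<times> UNIV. lightlike g (x, t) v \<longrightarrow>
        (\<forall>c\<in>charts_at A x. levi_civita_hessian A g (\<lambda>(q, s). \<phi> x q) c (x, t) v v < 0))"

end

theory Submission
  imports Defs
begin

text \<open>
  The reason is Fermat's principle in infinitesimal form. Fix a chart, let \<open>y \<noteq> 0\<close> and let
  \<open>\<tau> = F(y)\<close>, so that \<open>(y, \<tau>)\<close> is null and future-pointing. Then the spatial part of the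
  Levi-Civita coefficients \<open>\<Gamma>((y, \<tau>), (y, \<tau>))\<close> of the spacetime equals the Chern coefficients
  \<open>\<Gamma>\<^sub>y(y, y)\<close> of \<open>F\<close> plus a multiple of \<open>y\<close>: lightlike geodesics project to pregeodesics of \<open>F\<close>
  (lemma \<open>christoffel_L_eq_chern_connection\<close>). Since \<open>\<Phi>\<close> does not depend on time, the two Hessians
  at \<open>y\<close> differ by a multiple of \<open>d\<phi>(y)\<close>, which is zero for \<open>y\<close> tangent to the boundary
  (\<open>hessian_future_null\<close>, \<open>defining_function_boundary_deriv\<close>).

  A lightlike \<open>(y, \<tau>)\<close> has \<open>y \<noteq> 0\<close> and either \<open>\<tau> = F(y)\<close> or \<open>\<tau> = -F(-y)\<close>. In the second case
  \<open>(-y, -\<tau>)\<close> is of the first kind, and it has the same Hessian value, because the Hessian is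
  quadratic (\<open>hessian_uminus\<close>). So the values tested by the two convexity conditions are the same,
  and this settles the weak and the strong version at once (\<open>hessian_sign_condition_iff\<close>).

  The comparison of the connections rests on two observations. The Cartan tensor vanishes as soon as
  one argument is the reference vector, so the nonlinear connection drops out of \<open>\<Gamma>\<^sub>y(y, y)\<close>, which
  becomes the vector \<open>a\<close> of the Euler-Lagrange equations of \<open>F\<^sup>2\<close>. Writing \<open>\<partial>\<close> for derivatives in the
  position and subscripts for fibre derivatives, these equations split into
  \<open>F\<^sub>a = \<partial>\<^sub>yF\<close> and \<open>F\<^sub>a\<^sub>w = \<partial>\<^sub>yF\<^sub>w - \<partial>\<^sub>wF\<close>. On the other side,
  the identity \<open>g\<^sub>0(y,y) + 2 \<omega>\<^sub>0(y) F(y) - \<beta> F(y)\<^sup>2 = 0\<close>, its fibre derivatives, and the position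
  derivatives of these turn the equations for the Levi-Civita coefficients into equations for \<open>a\<close>,
  and nondegeneracy of the Lorentzian metric finishes the comparison.
\<close>

section \<open>Directional derivatives and duality\<close>

lemma frechet_derivative_cong_open:
  assumes "open V" "p \<in> V" "\<And>q. q \<in> V \<Longrightarrow> f q = h q"
  shows "frechet_derivative f (at p) = frechet_derivative h (at p)"
proof -
  have "(f has_derivative D) (at p) = (h has_derivative D) (at p)" for D
    using has_derivative_transform_within_open[of f D p UNIV V h]
      has_derivative_transform_within_open[of h D p UNIV V f] assms by auto
  then show ?thesis by (simp add: frechet_derivative_def)
qed

lemma frechet_derivative_eqI:
  "(f has_derivative D) (at p) \<Longrightarrow> frechet_derivative f (at p) = D"
  using frechet_derivative_at by metis

lemmas has_derivative_divide_const = bounded_linear.has_derivative[OF bounded_linear_divide]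

lemma differentiable_cong_open:
  assumes "open V" "p \<in> V" "\<And>q. q \<in> V \<Longrightarrow> f q = h q" "f differentiable (at p)"
  shows "h differentiable (at p)"
  using assms has_derivative_transform_within_open[of f _ p UNIV V h]
  unfolding differentiable_def by blast

lemma dir_deriv_works:
  "f differentiable (at p) \<Longrightarrow> (f has_derivative dir_deriv f p) (at p)"
  by (simp add: frechet_derivative_works)

lemma dir_deriv_minus:
  fixes f :: "'a::real_normed_vector \<Rightarrow> 'b::real_normed_vector"
  assumes "f differentiable (at p)"
  shows "dir_deriv (\<lambda>q. - f q) p u = - dir_deriv f p u"
  using frechet_derivative_eqI[OF has_derivative_minus[OF dir_deriv_works[OF assms]]] by simp

lemma linear_dir_deriv_param:
  fixes f :: "'a::real_normed_vector \<Rightarrow> 'b::real_normed_vector \<Rightarrow> real"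
  assumes "open V" "p \<in> V" "\<And>q. q \<in> V \<Longrightarrow> linear (f q)"
    and "\<And>w. (\<lambda>q. f q w) differentiable (at p)"
  shows "linear (\<lambda>w. dir_deriv (\<lambda>q. f q w) p u)"
proof (rule linearI)
  have D: "((\<lambda>q. f q w) has_derivative dir_deriv (\<lambda>q. f q w) p) (at p)" for w
    using assms(4) frechet_derivative_works by blast
  show "dir_deriv (\<lambda>q. f q (v + w)) p u = dir_deriv (\<lambda>q. f q v) p u + dir_deriv (\<lambda>q. f q w) p u" for v w
  proof -
    have "dir_deriv (\<lambda>q. f q (v + w)) p = dir_deriv (\<lambda>q. f q v + f q w) p"
      by (rule frechet_derivative_cong_open[OF assms(1,2)]) (simp add: assms(3) linear_add)
    then show ?thesis
      using frechet_derivative_eqI[OF has_derivative_add[OF D[of v] D[of w]]] by simp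
  qed
  show "dir_deriv (\<lambda>q. f q (c *\<^sub>R w)) p u = c *\<^sub>R dir_deriv (\<lambda>q. f q w) p u" for c w
  proof -
    have "dir_deriv (\<lambda>q. f q (c *\<^sub>R w)) p = dir_deriv (\<lambda>q. c * f q w) p"
      by (rule frechet_derivative_cong_open[OF assms(1,2)]) (simp add: assms(3) linear_scale)
    then show ?thesis
      using frechet_derivative_eqI[OF has_derivative_mult_right[OF D[of w], of c]] by simp
  qed
qed

text \<open>
  The description operator in \<^const>\<open>raise_form\<close> is well defined as soon as the bilinear form is
  nondegenerate, because an injective linear map of a Euclidean space into itself is onto.
\<close>

lemma raise_form_works:
  fixes B :: "'e::euclidean_space \<Rightarrow> 'e \<Rightarrow> real"
  assumes B: "bilinear B" and nondeg: "\<And>a. (\<And>w. B a w = 0) \<Longrightarrow> a = 0" and l: "linear l"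
  shows "B (raise_form B l) w = l w"
proof -
  define T where "T a = (\<Sum>i\<in>Basis. B a i *\<^sub>R i)" for a
  have Tl: "linear T"
    unfolding T_def using B
    by (intro linearI) (simp_all add: bilinear_ladd bilinear_lmul sum.distrib
        scaleR_left_distrib scaleR_sum_right)
  have ext: "B a w = m w" if "linear m" "\<And>i. i \<in> Basis \<Longrightarrow> B a i = m i" for a w and m :: "'e \<Rightarrow> real"
  proof -
    have "linear (B a)" using B by (simp add: bilinear_def)
    then show ?thesis using that linear_eq_stdbasis[of "B a" m] by auto
  qed
  have Ti: "T a \<bullet> i = B a i" if "i \<in> Basis" for a i
    using that by (simp add: T_def)
  have "a = 0" if "T a = 0" for a
  proof (rule nondeg)
    show "B a w = 0" for w
      using Ti[of _ a] that by (rule_tac ext[where m = "\<lambda>_. 0"]) (auto simp: linear_zero)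
  qed
  then have "inj T" using Tl by (simp add: linear_injective_0)
  then have "surj T" using Tl by (simp add: linear_injective_imp_surjective)
  then obtain a where "T a = (\<Sum>i\<in>Basis. l i *\<^sub>R i)" by (metis surjD)
  then have a: "B a w = l w" for w
    using Ti[of _ a] by (rule_tac ext[OF l]) (metis inner_sum_left_Basis)
  have "\<exists>!a. \<forall>w. B a w = l w"
  proof (rule ex1I[of _ a])
    fix a' assume "\<forall>w. B a' w = l w"
    then have "B (a' - a) w = 0" for w using a B by (simp add: bilinear_lsub)
    then show "a' = a" using nondeg[of "a' - a"] by simp
  qed (use a in blast)
  then have "\<forall>w. B (raise_form B l) w = l w"
    unfolding raise_form_def by (rule theI')
  then show ?thesis by blast
qed


section \<open>Christoffel symbols and Hessians in coordinates\<close>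

lemma christoffel_form_linear:
  assumes "open V" "p \<in> V" "\<And>q. q \<in> V \<Longrightarrow> bilinear (g q)"
    and "\<And>u v. (\<lambda>q. g q u v) differentiable (at p)"
  shows "linear (\<lambda>w. (dir_deriv (\<lambda>q. g q v w) p u + dir_deriv (\<lambda>q. g q u w) p v
        - dir_deriv (\<lambda>q. g q u v) p w) / (2::real))"
proof -
  have "linear (\<lambda>w. dir_deriv (\<lambda>q. g q v w) p u)" for u v
    using assms by (intro linear_dir_deriv_param[of V]) (auto simp: bilinear_def)
  moreover have "linear (dir_deriv (\<lambda>q. g q u v) p)"
    using assms(4) by (rule linear_frechet_derivative)
  ultimately have "linear (\<lambda>w. (1/2) *\<^sub>R (dir_deriv (\<lambda>q. g q v w) p u + dir_deriv (\<lambda>q. g q u w) p v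
        - dir_deriv (\<lambda>q. g q u v) p w))"
    by (intro linear_compose_scale_right linear_compose_add linear_compose_sub)
  then show ?thesis by simp
qed

lemma christoffel_works:
  fixes g :: "'e::euclidean_space \<Rightarrow> 'e \<Rightarrow> 'e \<Rightarrow> real"
  assumes "open V" "p \<in> V" "\<And>q. q \<in> V \<Longrightarrow> bilinear (g q)"
    and "\<And>u v. (\<lambda>q. g q u v) differentiable (at p)"
    and "\<And>a. (\<And>w. g p a w = 0) \<Longrightarrow> a = 0"
  shows "g p (christoffel g p u v) w = (dir_deriv (\<lambda>q. g q v w) p u + dir_deriv (\<lambda>q. g q u w) p v
        - dir_deriv (\<lambda>q. g q u v) p w) / 2"
  unfolding christoffel_def
  using raise_form_works[OF assms(3)[OF assms(2)] assms(5) christoffel_form_linear[OF assms(1-4)]]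
  by blast

lemma christoffel_uminus:
  fixes g :: "'e::euclidean_space \<Rightarrow> 'e \<Rightarrow> 'e \<Rightarrow> real"
  assumes V: "open V" "p \<in> V" and g: "\<And>q. q \<in> V \<Longrightarrow> bilinear (g q)"
    and d: "\<And>u v. (\<lambda>q. g q u v) differentiable (at p)"
  shows "christoffel g p (- u) (- v) = christoffel g p u v"
proof -
  have "dir_deriv (\<lambda>q. g q (- v) w) p (- u) = dir_deriv (\<lambda>q. g q v w) p u" for u v w
  proof -
    have "dir_deriv (\<lambda>q. g q (- v) w) p = dir_deriv (\<lambda>q. - g q v w) p"
      by (rule frechet_derivative_cong_open[OF V]) (simp add: g bilinear_lneg)
    then show ?thesis
      using linear_frechet_derivative[OF d] by (simp add: dir_deriv_minus d linear_neg)
  qed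
  moreover have "dir_deriv (\<lambda>q. g q (- u) (- v)) p = dir_deriv (\<lambda>q. g q u v) p"
    by (rule frechet_derivative_cong_open[OF V]) (simp add: g bilinear_lneg bilinear_rneg)
  ultimately show ?thesis by (simp add: christoffel_def)
qed

text \<open>The Hessian of a function on a product that depends on the first factor only.\<close>

lemma covariant_hessian_fst:
  fixes f :: "'e::euclidean_space \<Rightarrow> real" and G :: "'e \<times> real \<Rightarrow> 'e \<times> real \<Rightarrow> 'e \<times> real"
  assumes U: "open U" "p \<in> U" and f: "\<And>q. q \<in> U \<Longrightarrow> f differentiable (at q)"
    and f2: "(\<lambda>q. dir_deriv f q (fst v)) differentiable (at p)"
  shows "covariant_hessian (\<lambda>(q, s). f q) G (p, t) u v =
    dir_deriv (\<lambda>q. dir_deriv f q (fst v)) p (fst u) - dir_deriv f p (fst (G u v))"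
proof -
  have fst: "dir_deriv (\<lambda>z. h (fst z)) (q, s) = (\<lambda>n. dir_deriv h q (fst n))"
    if "h differentiable (at q)" for h :: "'e \<Rightarrow> real" and q and s :: real
    using dir_deriv_works[OF that]
    by (intro frechet_derivative_eqI has_derivative_compose[OF has_derivative_fst[OF has_derivative_ident]])
      simp
  have "dir_deriv (\<lambda>z. dir_deriv (\<lambda>z. f (fst z)) z v) (p, t) =
      dir_deriv (\<lambda>z. dir_deriv f (fst z) (fst v)) (p, t)"
    by (rule frechet_derivative_cong_open[of "U \<times> UNIV"])
      (use U f in \<open>auto simp: fst intro: open_Times\<close>)
  then show ?thesis
    using fst[OF f2, of t] fst[OF f[OF U(2)], of t]
    by (simp add: covariant_hessian_def case_prod_unfold)
qed


section \<open>The Fermat metric in coordinates\<close>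

text \<open>
  The coordinate expressions of \<open>g\<^sub>0\<close>, \<open>\<omega>\<^sub>0\<close> and \<open>\<beta>\<close> on the image \<open>V\<close> of a chart. Nothing is
  assumed outside \<open>V\<close>, and first order differentiability in the position is all that is needed.
\<close>

locale stationary_coordinates =
  fixes V :: "'e::euclidean_space set"
    and g :: "'e \<Rightarrow> 'e \<Rightarrow> 'e \<Rightarrow> real"
    and \<omega> :: "'e \<Rightarrow> 'e \<Rightarrow> real"
    and \<beta> :: "'e \<Rightarrow> real"
  assumes open_V: "open V"
    and g_bilinear: "q \<in> V \<Longrightarrow> bilinear (g q)"
    and g_sym: "q \<in> V \<Longrightarrow> g q u v = g q v u"
    and g_pos: "q \<in> V \<Longrightarrow> u \<noteq> 0 \<Longrightarrow> g q u u > 0"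
    and \<omega>_linear: "q \<in> V \<Longrightarrow> linear (\<omega> q)"
    and \<beta>_pos: "q \<in> V \<Longrightarrow> \<beta> q > 0"
    and g_diff: "q \<in> V \<Longrightarrow> (\<lambda>q. g q u v) differentiable (at q)"
    and \<omega>_diff: "q \<in> V \<Longrightarrow> (\<lambda>q. \<omega> q u) differentiable (at q)"
    and \<beta>_diff: "q \<in> V \<Longrightarrow> \<beta> differentiable (at q)"
begin

text \<open>The Fermat metric, where \<open>g\<close> and \<open>\<omega>\<close> stand for \<open>g\<^sub>0\<close> and \<open>\<omega>\<^sub>0\<close>.\<close>

definition F :: "'e \<Rightarrow> 'e \<Rightarrow> real" where
  "F q z = sqrt ((\<omega> q z)\<^sup>2 / (\<beta> q)\<^sup>2 + g q z z / \<beta> q) + \<omega> q z / \<beta> q"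

text \<open>
  With \<open>h\<close> the Riemannian part of the Randers metric, \<open>r\<close> is the bilinear form of \<open>\<beta>\<^sup>2 h\<close>
  and \<open>S\<close> its norm, so that \<open>F = (S + \<omega>) / \<beta>\<close>.
\<close>

definition r :: "'e \<Rightarrow> 'e \<Rightarrow> 'e \<Rightarrow> real" where
  "r q u w = \<omega> q u * \<omega> q w + \<beta> q * g q u w"

definition S :: "'e \<Rightarrow> 'e \<Rightarrow> real" where
  "S q z = sqrt (r q z z)"

text \<open>
  The first and second derivatives of \<open>F q\<close> along the fibre at \<open>z \<noteq> 0\<close>, in the directions \<open>w\<close>
  and \<open>u\<close>, \<open>w\<close>.
\<close>

definition F1 :: "'e \<Rightarrow> 'e \<Rightarrow> 'e \<Rightarrow> real" where
  "F1 q z w = (r q z w / S q z + \<omega> q w) / \<beta> q"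

definition F2 :: "'e \<Rightarrow> 'e \<Rightarrow> 'e \<Rightarrow> 'e \<Rightarrow> real" where
  "F2 q z u w = (r q u w / S q z - r q z u * r q z w / (S q z) ^ 3) / \<beta> q"

lemma r_bilinear: assumes "q \<in> V" shows "bilinear (r q)"
  unfolding bilinear_def r_def
  using g_bilinear[OF assms] \<omega>_linear[OF assms]
  by (auto intro!: linearI simp: bilinear_ladd bilinear_radd bilinear_lmul bilinear_rmul
      linear_add linear_scale algebra_simps)

lemma r_sym: "q \<in> V \<Longrightarrow> r q u v = r q v u"
  by (simp add: r_def g_sym)

lemma r_gt: "q \<in> V \<Longrightarrow> z \<noteq> 0 \<Longrightarrow> r q z z > (\<omega> q z)\<^sup>2"
  by (simp add: r_def \<beta>_pos g_pos power2_eq_square)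

lemma r_pos: "q \<in> V \<Longrightarrow> z \<noteq> 0 \<Longrightarrow> r q z z > 0"
  using r_gt[of q z] zero_le_power2[of "\<omega> q z"] by linarith

lemma S_pos: "q \<in> V \<Longrightarrow> z \<noteq> 0 \<Longrightarrow> S q z > 0"
  by (simp add: S_def r_pos)

lemma S_square: "q \<in> V \<Longrightarrow> z \<noteq> 0 \<Longrightarrow> (S q z)\<^sup>2 = r q z z"
  using r_pos[of q z] by (simp add: S_def)

lemma S_gt: assumes "q \<in> V" "z \<noteq> 0" shows "S q z > \<bar>\<omega> q z\<bar>"
  using r_gt[OF assms] real_sqrt_less_mono by (fastforce simp: S_def)

lemma F_eq: assumes "q \<in> V" shows "F q z = (S q z + \<omega> q z) / \<beta> q"
proof -
  have "(\<omega> q z)\<^sup>2 / (\<beta> q)\<^sup>2 + g q z z / \<beta> q = r q z z / (\<beta> q)\<^sup>2"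
    using \<beta>_pos[OF assms] by (simp add: r_def field_simps power2_eq_square)
  then show ?thesis
    using \<beta>_pos[OF assms] by (simp add: F_def S_def real_sqrt_divide add_divide_distrib)
qed

lemma F_pos: assumes "q \<in> V" "z \<noteq> 0" shows "F q z > 0"
  using S_gt[OF assms] \<beta>_pos[OF assms(1)] by (simp add: F_eq assms(1))

lemma F1_self: assumes "q \<in> V" "z \<noteq> 0" shows "F1 q z z = F q z"
  using S_pos[OF assms] S_square[OF assms, symmetric]
  by (simp add: F1_def F_eq assms(1) power2_eq_square)

lemma F2_self: assumes "q \<in> V" "z \<noteq> 0" shows "F2 q z u z = 0" "F2 q z z u = 0"
  using S_pos[OF assms] S_square[OF assms, symmetric]
  by (simp_all add: F2_def r_sym[OF assms(1), of u z] power2_eq_square power3_eq_cube)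

lemma r_has_derivative:
  assumes "q \<in> V" shows "((\<lambda>z. r q z w) has_derivative (\<lambda>n. r q n w)) (at z)"
  using r_bilinear[OF assms] by (intro linear_imp_has_derivative) (simp add: bilinear_def)

lemma S_has_derivative:
  assumes "q \<in> V" "z \<noteq> 0"
  shows "(S q has_derivative (\<lambda>n. r q z n / S q z)) (at z)"
proof -
  interpret bounded_bilinear "r q"
    using r_bilinear[OF assms(1)] by (simp add: bilinear_conv_bounded_bilinear)
  have "((\<lambda>z. r q z z) has_derivative (\<lambda>n. r q z n + r q n z)) (at z)"
    by (rule FDERIV) (auto intro: has_derivative_ident)
  then show ?thesis
    unfolding S_def[abs_def]
    by (rule has_derivative_eq_rhs[OF has_derivative_real_sqrt[where g = "\<lambda>z. r q z z", OF r_pos[OF assms]]])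
      (simp add: fun_eq_iff r_sym[OF assms(1)] field_simps)
qed

lemma F_has_derivative:
  assumes "q \<in> V" "z \<noteq> 0" shows "(F q has_derivative F1 q z) (at z)"
proof -
  have "((\<lambda>z. (S q z + \<omega> q z) / \<beta> q) has_derivative F1 q z) (at z)"
    unfolding F1_def[abs_def]
    by (intro has_derivative_divide_const has_derivative_add S_has_derivative assms
        linear_imp_has_derivative \<omega>_linear)
  moreover have "F q = (\<lambda>z. (S q z + \<omega> q z) / \<beta> q)"
    using F_eq[OF assms(1)] by (simp add: fun_eq_iff)
  ultimately show ?thesis by simp
qed

lemma F1_has_derivative:
  assumes "q \<in> V" "z \<noteq> 0"
  shows "((\<lambda>z. F1 q z w) has_derivative (\<lambda>u. F2 q z u w)) (at z)"
proof -
  have S: "S q z \<noteq> 0" using S_pos[OF assms] by simp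
  have "((\<lambda>z. F1 q z w) has_derivative (\<lambda>u.
      ((r q u w * S q z - r q z w * (r q z u / S q z)) / (S q z * S q z) + 0) / \<beta> q)) (at z)"
    unfolding F1_def
    by (rule has_derivative_divide_const[OF has_derivative_add[OF
          has_derivative_divide'[OF r_has_derivative[OF assms(1)] S_has_derivative[OF assms] S]
          has_derivative_const]])
  moreover have "(r q u w * S q z - r q z w * (r q z u / S q z)) / (S q z * S q z) =
      r q u w / S q z - r q z u * r q z w / (S q z) ^ 3" for u
    using S by (simp add: divide_simps power3_eq_cube)
  ultimately show ?thesis unfolding F2_def by (simp only: add_0_right)
qed

text \<open>
  The form \<open>F2 q z\<close> is homogeneous of degree \<open>-1\<close> in \<open>z\<close> and kills \<open>z\<close>; differentiating
  \<open>F2 q z z w = 0\<close> gives this instance of its fibre derivative, which is all that is needed.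
\<close>

lemma F2_has_derivative:
  assumes "q \<in> V" "y \<noteq> 0"
  shows "((\<lambda>z. F2 q z y w) has_derivative (\<lambda>n. - F2 q y n w)) (at y)"
proof -
  note S = S_has_derivative[OF assms] and R = r_has_derivative[OF assms(1)]
  have S0: "S q y \<noteq> 0" "S q y ^ 3 \<noteq> 0" using S_pos[OF assms] by simp_all
  have "((\<lambda>z. F2 q z y w) has_derivative (\<lambda>n.
     ((0 * S q y - r q y w * (r q y n / S q y)) / (S q y * S q y) -
     ((r q y y * r q n w + r q n y * r q y w) * S q y ^ 3
       - r q y y * r q y w * (of_nat 3 * (r q y n / S q y) * S q y ^ (3 - 1)))
       / (S q y ^ 3 * S q y ^ 3)) / \<beta> q)) (at y)"
    unfolding F2_def
    by (rule has_derivative_divide_const[OF has_derivative_diff[OF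
          has_derivative_divide'[OF has_derivative_const S S0(1)]
          has_derivative_divide'[OF has_derivative_mult[OF R R] has_derivative_power[OF S] S0(2)]]])
  moreover have "(0 * S q y - r q y w * (r q y n / S q y)) / (S q y * S q y) -
     ((r q y y * r q n w + r q n y * r q y w) * S q y ^ 3
       - r q y y * r q y w * (of_nat 3 * (r q y n / S q y) * S q y ^ (3 - 1))) / (S q y ^ 3 * S q y ^ 3)
     = - (r q n w / S q y - r q y n * r q y w / (S q y) ^ 3)" for n
    unfolding r_sym[OF assms(1), of n y] S_square[OF assms, symmetric]
    using S0 by (simp add: divide_simps eval_nat_numeral) (simp add: algebra_simps)
  ultimately show ?thesis unfolding F2_def by (simp only: minus_divide_left)
qed

lemma fundamental_tensor_F:
  assumes "q \<in> V" "z \<noteq> 0"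
  shows "fundamental_tensor F q z u w = F1 q z u * F1 q z w + F q z * F2 q z u w"
proof -
  have 1: "dir_deriv (\<lambda>z'. (F q z')\<^sup>2) z w = 2 * (F q z * F1 q z w)" if "z \<noteq> 0" for z
    using frechet_derivative_eqI[OF has_derivative_power[OF F_has_derivative[OF assms(1) that], of 2]]
    by simp
  have "dir_deriv (\<lambda>z. dir_deriv (\<lambda>z'. (F q z')\<^sup>2) z w) z =
      dir_deriv (\<lambda>z. 2 * (F q z * F1 q z w)) z"
    by (rule frechet_derivative_cong_open[of "- {0}"]) (use assms 1 in auto)
  also have "\<dots> = (\<lambda>u. 2 * (F q z * F2 q z u w + F1 q z u * F1 q z w))"
    by (intro frechet_derivative_eqI has_derivative_mult_right has_derivative_mult
        F_has_derivative F1_has_derivative assms)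
  finally show ?thesis by (simp add: fundamental_tensor_def algebra_simps)
qed

text \<open>The Cartan tensor vanishes when one of its arguments is the reference vector.\<close>

lemma fundamental_tensor_vertical_deriv:
  assumes "q \<in> V" "y \<noteq> 0"
  shows "dir_deriv (\<lambda>z. fundamental_tensor F q z y w) y = (\<lambda>n. 0)"
proof -
  have "dir_deriv (\<lambda>z. fundamental_tensor F q z y w) y =
      dir_deriv (\<lambda>z. F1 q z y * F1 q z w + F q z * F2 q z y w) y"
    by (rule frechet_derivative_cong_open[of "- {0}"]) (use assms fundamental_tensor_F in auto)
  also have "\<dots> = (\<lambda>n. (F1 q y y * F2 q y n w + F2 q y n y * F1 q y w)
      + (F q y * (- F2 q y n w) + F1 q y n * F2 q y y w))"
    by (intro frechet_derivative_eqI has_derivative_add has_derivative_mult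
        F_has_derivative F1_has_derivative F2_has_derivative assms)
  also have "\<dots> = (\<lambda>n. 0)"
    using assms by (simp add: F2_self F1_self)
  finally show ?thesis .
qed

lemma fundamental_tensor_bilinear:
  assumes "q \<in> V" "z \<noteq> 0" shows "bilinear (fundamental_tensor F q z)"
proof -
  have F1: "linear (F1 q z)" using F_has_derivative[OF assms] has_derivative_linear by blast
  have F2: "bilinear (F2 q z)"
    unfolding bilinear_def F2_def using r_bilinear[OF assms(1)]
    by (auto intro!: linearI simp: bilinear_ladd bilinear_radd bilinear_lmul
      bilinear_rmul algebra_simps add_divide_distrib diff_divide_distrib)
  show ?thesis
    unfolding bilinear_def fundamental_tensor_F[OF assms]
    using F1 F2
    by (auto intro!: linearI simp: bilinear_ladd bilinear_radd bilinear_lmul bilinear_rmul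
      linear_add linear_scale algebra_simps)
qed

text \<open>
  In \<open>F1 \<otimes> F1 + F F2\<close> the form \<open>F2\<close> has kernel spanned by \<open>z\<close>, while \<open>F1 q z z = F q z > 0\<close>.
\<close>

lemma fundamental_tensor_nondegenerate:
  assumes "q \<in> V" "z \<noteq> 0" and 0: "\<And>w. fundamental_tensor F q z a w = 0"
  shows "a = 0"
proof -
  have F: "F q z > 0" by (rule F_pos) fact+
  have "F1 q z a = 0"
    using 0[of z] F by (simp add: fundamental_tensor_F F2_self F1_self assms(1,2))
  then have F2: "F2 q z a w = 0" for w
    using 0[of w] F \<open>F1 q z a = 0\<close> by (simp add: fundamental_tensor_F assms(1,2))
  \<comment> \<open>\<open>F2 q z a = 0\<close> says that \<open>a\<close> equals its \<open>r\<close>-orthogonal projection onto \<open>z\<close>.\<close>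
  define c where "c = r q z a / (S q z)\<^sup>2"
  have "r q (a - c *\<^sub>R z) w = 0" for w
    using F2[of w] S_pos[OF assms(1,2)] \<beta>_pos[OF assms(1)] r_bilinear[OF assms(1)]
    by (simp add: F2_def c_def bilinear_lsub bilinear_lmul field_simps eval_nat_numeral)
  then have a: "a = c *\<^sub>R z" using r_pos[OF assms(1), of "a - c *\<^sub>R z"] by fastforce
  have "linear (F1 q z)" using F_has_derivative[OF assms(1,2)] has_derivative_linear by blast
  then have "c * F q z = 0"
    using \<open>F1 q z a = 0\<close> F1_self[OF assms(1,2)] by (simp add: a linear_scale)
  then show ?thesis using a F by simp
qed

lemma \<beta>_has: "p \<in> V \<Longrightarrow> (\<beta> has_derivative dir_deriv \<beta> p) (at p)"
  and \<omega>_has: "p \<in> V \<Longrightarrow> ((\<lambda>q. \<omega> q u) has_derivative dir_deriv (\<lambda>q. \<omega> q u) p) (at p)"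
  and g_has: "p \<in> V \<Longrightarrow> ((\<lambda>q. g q u v) has_derivative dir_deriv (\<lambda>q. g q u v) p) (at p)"
  by (simp_all add: dir_deriv_works \<beta>_diff \<omega>_diff g_diff)

lemma r_diff: "p \<in> V \<Longrightarrow> (\<lambda>q. r q u w) differentiable (at p)"
  unfolding r_def by (intro differentiable_add differentiable_mult \<omega>_diff \<beta>_diff g_diff)

lemma S_diff: assumes "p \<in> V" "z \<noteq> 0" shows "(\<lambda>q. S q z) differentiable (at p)"
  unfolding S_def
  using has_derivative_real_sqrt[where g = "\<lambda>q. r q z z", OF r_pos[OF assms]
      dir_deriv_works[OF r_diff[OF assms(1)]]]
  by (rule differentiableI)

lemma F1_diff: assumes "p \<in> V" "z \<noteq> 0" shows "(\<lambda>q. F1 q z w) differentiable (at p)"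
  unfolding F1_def
  using S_pos[OF assms] \<beta>_pos[OF assms(1)]
  by (intro differentiable_divide differentiable_add r_diff S_diff \<omega>_diff \<beta>_diff assms) auto

lemma F_diff: assumes "p \<in> V" "z \<noteq> 0" shows "(\<lambda>q. F q z) differentiable (at p)"
  by (rule differentiable_cong_open[OF open_V assms(1) _ F1_diff[OF assms, of z]])
    (simp add: F1_self assms)

lemma F1_linear: assumes "q \<in> V" "z \<noteq> 0" shows "linear (F1 q z)"
  using F_has_derivative[OF assms] has_derivative_linear by blast

text \<open>
  For \<open>y\<close> in both slots the nonlinear connection only enters through the Cartan tensor applied to
  the reference vector, hence not at all, and the Chern coefficients are the formal Christoffel
  symbols of the fundamental tensor.
\<close>

lemma chern_connection_works:
  assumes p: "p \<in> V" and y: "y \<noteq> 0"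
  shows "fundamental_tensor F p y (chern_connection F p y y y) w =
    dir_deriv (\<lambda>q. F q y) p y * F1 p y w +
    F p y * (dir_deriv (\<lambda>q. F1 q y w) p y - dir_deriv (\<lambda>q. F q y) p w)"
proof -
  note D = has_derivative_mult[OF dir_deriv_works[OF F_diff[OF p y]] dir_deriv_works[OF F1_diff[OF p y]]]
  have 1: "dir_deriv (\<lambda>q. fundamental_tensor F q y y w) p u =
      F p y * dir_deriv (\<lambda>q. F1 q y w) p u + dir_deriv (\<lambda>q. F q y) p u * F1 p y w" for u w
  proof -
    have "dir_deriv (\<lambda>q. fundamental_tensor F q y y w) p = dir_deriv (\<lambda>q. F q y * F1 q y w) p"
      by (rule frechet_derivative_cong_open[OF open_V p])
        (simp add: fundamental_tensor_F y F1_self F2_self)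
    then show ?thesis using frechet_derivative_eqI[OF D[of w]] by simp
  qed
  have 2: "dir_deriv (\<lambda>q. F1 q y y) p = dir_deriv (\<lambda>q. F q y) p"
    by (rule frechet_derivative_cong_open[OF open_V p]) (simp add: F1_self y)
  have hd: "horizontal_deriv F (\<lambda>q z. fundamental_tensor F q z y w) p y u =
      dir_deriv (\<lambda>q. fundamental_tensor F q y y w) p u" for u w
    by (simp add: horizontal_deriv_def fundamental_tensor_vertical_deriv p y)
  have l: "(horizontal_deriv F (\<lambda>q z. fundamental_tensor F q z y w) p y y
      + horizontal_deriv F (\<lambda>q z. fundamental_tensor F q z y w) p y y
      - horizontal_deriv F (\<lambda>q z. fundamental_tensor F q z y y) p y w) / 2 =
    dir_deriv (\<lambda>q. F q y) p y * F1 p y w +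
    F p y * (dir_deriv (\<lambda>q. F1 q y w) p y - dir_deriv (\<lambda>q. F q y) p w)" for w
    unfolding hd 1 2 by (simp add: F1_self p y field_simps)
  have "linear (\<lambda>w. dir_deriv (\<lambda>q. F1 q y w) p y)"
    by (rule linear_dir_deriv_param[OF open_V p F1_linear[OF _ y] F1_diff[OF p y]])
  then have "linear (\<lambda>w. dir_deriv (\<lambda>q. F q y) p y *\<^sub>R F1 p y w +
    F p y *\<^sub>R (dir_deriv (\<lambda>q. F1 q y w) p y - dir_deriv (\<lambda>q. F q y) p w))"
    using F1_linear[OF p y] linear_frechet_derivative[OF F_diff[OF p y]]
    by (intro linear_compose_scale_right linear_compose_add linear_compose_sub)
  then have "linear (\<lambda>w. dir_deriv (\<lambda>q. F q y) p y * F1 p y w +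
    F p y * (dir_deriv (\<lambda>q. F1 q y w) p y - dir_deriv (\<lambda>q. F q y) p w))"
    by simp
  moreover have "b = 0" if "\<And>w. fundamental_tensor F p y b w = 0" for b
    using p y that by (rule fundamental_tensor_nondegenerate)
  ultimately show ?thesis
    unfolding chern_connection_def l
    using raise_form_works[OF fundamental_tensor_bilinear[OF p y]] by blast
qed

text \<open>
  The Euler-Lagrange equations of \<open>F\<^sup>2\<close>, split into the component along \<open>y\<close> and the rest: the first
  says that \<open>F\<close> is constant along geodesics, the second is the Euler-Lagrange equation of \<open>F\<close>.
\<close>

lemma fermat_geodesic_equations:
  assumes p: "p \<in> V" and y: "y \<noteq> 0"
  defines "a \<equiv> chern_connection F p y y y"
  shows "F1 p y a = dir_deriv (\<lambda>q. F q y) p y"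
    and "F2 p y a w = dir_deriv (\<lambda>q. F1 q y w) p y - dir_deriv (\<lambda>q. F q y) p w"
proof -
  have F: "F p y > 0" by (rule F_pos) fact+
  have 2: "dir_deriv (\<lambda>q. F1 q y y) p = dir_deriv (\<lambda>q. F q y) p"
    by (rule frechet_derivative_cong_open[OF open_V p]) (simp add: F1_self y)
  note eq = chern_connection_works[OF p y, folded a_def, unfolded fundamental_tensor_F[OF p y]]
  show 1: "F1 p y a = dir_deriv (\<lambda>q. F q y) p y"
    using eq[of y] F by (simp add: 2 F1_self[OF p y] F2_self[OF p y])
  show "F2 p y a w = dir_deriv (\<lambda>q. F1 q y w) p y - dir_deriv (\<lambda>q. F q y) p w"
    using eq[of w] F by (simp add: 1)
qed

text \<open>The Lorentzian metric of the spacetime.\<close>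

definition L :: "'e \<times> real \<Rightarrow> 'e \<times> real \<Rightarrow> 'e \<times> real \<Rightarrow> real" where
  "L = (\<lambda>(q, s) (u, \<tau>) (v, \<sigma>). g q u v + \<omega> q u * \<sigma> + \<omega> q v * \<tau> - \<beta> q * \<tau> * \<sigma>)"

lemma L_bilinear: assumes "z \<in> V \<times> UNIV" shows "bilinear (L z)"
proof -
  have q: "fst z \<in> V" using assms by auto
  show ?thesis
    unfolding bilinear_def L_def
    using g_bilinear[OF q] \<omega>_linear[OF q]
    by (auto intro!: linearI simp: case_prod_unfold bilinear_ladd bilinear_lmul bilinear_radd bilinear_rmul
       linear_add linear_scale algebra_simps)
qed

lemma L_nondegenerate:
  assumes p: "p \<in> V" and 0: "\<And>w. L (p, t) a w = 0"
  shows "a = 0"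
proof -
  obtain A T where a: "a = (A, T)" by fastforce
  have "g p A 0 = 0" "\<omega> p 0 = 0"
    using g_bilinear[OF p] \<omega>_linear[OF p] by (simp_all add: bilinear_rzero linear_0)
  then have 1: "\<omega> p A = \<beta> p * T" using 0[of "(0, 1)"] by (simp add: L_def a)
  have "g p A A + \<beta> p * T\<^sup>2 = 0"
    using 0[of "(A, 0)"] by (simp add: L_def a 1 power2_eq_square)
  moreover have "\<beta> p * T\<^sup>2 \<ge> 0" using \<beta>_pos[OF p] by simp
  ultimately have "A = 0" using g_pos[OF p, of A] by fastforce
  then show ?thesis
    using 1 \<beta>_pos[OF p] \<open>\<omega> p 0 = 0\<close> by (simp add: a zero_prod_def)
qed

lemma L_has_derivative:
  assumes "p \<in> V"
  shows "((\<lambda>z. L z (v, \<tau>) (w, \<sigma>)) has_derivative (\<lambda>n.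
     dir_deriv (\<lambda>q. g q v w) p (fst n) + dir_deriv (\<lambda>q. \<omega> q v) p (fst n) * \<sigma>
     + dir_deriv (\<lambda>q. \<omega> q w) p (fst n) * \<tau> - dir_deriv \<beta> p (fst n) * \<tau> * \<sigma>)) (at (p, t))"
proof -
  have fst: "(fst has_derivative fst) (at (p, t))"
    by (rule has_derivative_fst[OF has_derivative_ident])
  have "((\<lambda>q. g q v w + \<omega> q v * \<sigma> + \<omega> q w * \<tau> - \<beta> q * \<tau> * \<sigma>) has_derivative (\<lambda>n.
     dir_deriv (\<lambda>q. g q v w) p n + dir_deriv (\<lambda>q. \<omega> q v) p n * \<sigma>
     + dir_deriv (\<lambda>q. \<omega> q w) p n * \<tau> - dir_deriv \<beta> p n * \<tau> * \<sigma>)) (at (fst (p, t)))"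
    using assms
    by (auto intro!: has_derivative_add has_derivative_diff has_derivative_mult_left g_has \<omega>_has \<beta>_has)
  from has_derivative_compose[OF fst this] show ?thesis
    by (simp add: L_def case_prod_unfold)
qed

lemma L_diff: assumes "p \<in> V" shows "(\<lambda>z. L z u v) differentiable (at (p, t))"
  using L_has_derivative[OF assms, of "fst u" "snd u" "fst v" "snd v"]
  by (auto intro: differentiableI)

lemma L_christoffel:
  assumes p: "p \<in> V" and A: "christoffel L (p, t) (y, \<tau>) (y, \<tau>) = (A, T)"
  shows "g p A w + \<omega> p A * \<sigma> + \<omega> p w * T - \<beta> p * T * \<sigma> =
    dir_deriv (\<lambda>q. g q y w) p y + dir_deriv (\<lambda>q. \<omega> q y) p y * \<sigma>
     + dir_deriv (\<lambda>q. \<omega> q w) p y * \<tau> - dir_deriv \<beta> p y * \<tau> * \<sigma>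
     - (dir_deriv (\<lambda>q. g q y y) p w + 2 * dir_deriv (\<lambda>q. \<omega> q y) p w * \<tau> - dir_deriv \<beta> p w * \<tau> * \<tau>) / 2"
proof -
  have D: "dir_deriv (\<lambda>z. L z (v, \<tau>) (w, \<sigma>)) (p, t) = (\<lambda>n.
     dir_deriv (\<lambda>q. g q v w) p (fst n) + dir_deriv (\<lambda>q. \<omega> q v) p (fst n) * \<sigma>
     + dir_deriv (\<lambda>q. \<omega> q w) p (fst n) * \<tau> - dir_deriv \<beta> p (fst n) * \<tau> * \<sigma>)" for v \<tau> w \<sigma>
    by (rule frechet_derivative_eqI[OF L_has_derivative[OF p]])
  have "L (p, t) (A, T) (w, \<sigma>) = (dir_deriv (\<lambda>z. L z (y, \<tau>) (w, \<sigma>)) (p, t) (y, \<tau>)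
      + dir_deriv (\<lambda>z. L z (y, \<tau>) (w, \<sigma>)) (p, t) (y, \<tau>)
      - dir_deriv (\<lambda>z. L z (y, \<tau>) (y, \<tau>)) (p, t) (w, \<sigma>)) / 2"
    unfolding A[symmetric]
    by (rule christoffel_works[of "V \<times> UNIV"])
      (use p open_V in \<open>auto intro: open_Times L_bilinear L_diff L_nondegenerate[of p t]\<close>)
  then show ?thesis unfolding D by (simp add: L_def field_simps)
qed

text \<open>
  The vector \<open>(z, F z)\<close> is null; the other two identities are the first and second fibre derivatives
  of this one.
\<close>

lemma F_null:
  assumes "q \<in> V" "z \<noteq> 0"
  shows "g q z z + 2 * \<omega> q z * F q z - \<beta> q * F q z * F q z = 0"
    and "g q z w + \<omega> q w * F q z = (\<beta> q * F q z - \<omega> q z) * F1 q z w"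
    and "g q u w + \<omega> q w * F1 q z u = (\<beta> q * F1 q z u - \<omega> q u) * F1 q z w + (\<beta> q * F q z - \<omega> q z) * F2 q z u w"
proof -
  have b: "\<beta> q > 0" and S: "S q z > 0" using assms by (simp_all add: \<beta>_pos S_pos)
  have g: "g q u w = (r q u w - \<omega> q u * \<omega> q w) / \<beta> q" for u w
    using b by (simp add: r_def)
  have SF: "\<beta> q * F q z - \<omega> q z = S q z" using b by (simp add: F_eq assms(1))
  show "g q z z + 2 * \<omega> q z * F q z - \<beta> q * F q z * F q z = 0"
    unfolding g S_square[OF assms, symmetric]
    using b by (simp add: F_eq assms(1) field_simps power2_eq_square)
  show "g q z w + \<omega> q w * F q z = (\<beta> q * F q z - \<omega> q z) * F1 q z w"
    unfolding SF unfolding g F1_def F_eq[OF assms(1)]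
    using b S by (simp add: field_simps)
  show "g q u w + \<omega> q w * F1 q z u = (\<beta> q * F1 q z u - \<omega> q u) * F1 q z w + (\<beta> q * F q z - \<omega> q z) * F2 q z u w"
    unfolding SF unfolding g F1_def F2_def
    using b S by (simp add: field_simps eval_nat_numeral)
qed

text \<open>Lightlike geodesics project to pregeodesics of the Fermat metric.\<close>

lemma christoffel_L_eq_chern_connection:
  assumes p: "p \<in> V" and y: "y \<noteq> 0"
  shows "\<exists>\<nu>. fst (christoffel L (p, t) (y, F p y) (y, F p y)) = chern_connection F p y y y + \<nu> *\<^sub>R y"
proof -
  obtain A T where A: "christoffel L (p, t) (y, F p y) (y, F p y) = (A, T)" by fastforce
  define a where "a = chern_connection F p y y y"
  define dg d\<omega> d\<beta> dF dF1 where "dg u v w = dir_deriv (\<lambda>q. g q v w) p u"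
    and "d\<omega> u v = dir_deriv (\<lambda>q. \<omega> q v) p u" and "d\<beta> u = dir_deriv \<beta> p u"
    and "dF u = dir_deriv (\<lambda>q. F q y) p u" and "dF1 u w = dir_deriv (\<lambda>q. F1 q y w) p u" for u v w
  note d = dg_def d\<omega>_def d\<beta>_def dF_def dF1_def
  \<comment> \<open>The value of \<open>\<nu>\<close> is forced by the time component of the equation for \<open>(A, T)\<close>.\<close>
  define \<nu> where "\<nu> = (d\<beta> y * F p y - d\<omega> y y + \<omega> p a) / (\<beta> p * F p y - \<omega> p y)"
  have S: "\<beta> p * F p y - \<omega> p y > 0"
    using S_pos[OF p y] \<beta>_pos[OF p] by (simp add: F_eq p)
  have \<nu>: "\<nu> * (\<beta> p * F p y - \<omega> p y) = d\<beta> y * F p y - d\<omega> y y + \<omega> p a"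
    using S by (simp add: \<nu>_def)
  have a1: "F1 p y a = dF y" and a2: "F2 p y a w = dF1 y w - dF w" for w
    unfolding d a_def by (rule fermat_geodesic_equations[OF p y])+
  note has = g_has[OF p] \<omega>_has[OF p] \<beta>_has[OF p] dir_deriv_works[OF F_diff[OF p y]]
    dir_deriv_works[OF F1_diff[OF p y]]
  \<comment> \<open>Position derivatives of the null identity (\<open>I1\<close>) and of its fibre derivative (\<open>I2\<close>); \<open>I3\<close> is
    the second fibre derivative with the geodesic equations inserted.\<close>
  have I1: "dg w y y + 2 * d\<omega> w y * F p y + 2 * \<omega> p y * dF w
      - d\<beta> w * F p y * F p y - 2 * \<beta> p * F p y * dF w = 0" for w
  proof -
    have "dir_deriv (\<lambda>q. g q y y + 2 * \<omega> q y * F q y - \<beta> q * F q y * F q y) p = dir_deriv (\<lambda>q. 0) p"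
      by (rule frechet_derivative_cong_open[OF open_V p]) (rule F_null(1)[OF _ y])
    moreover have "dir_deriv (\<lambda>q. g q y y + 2 * \<omega> q y * F q y - \<beta> q * F q y * F q y) p =
        (\<lambda>w. dg w y y + ((2 * \<omega> p y) * dF w + (2 * d\<omega> w y) * F p y)
          - ((\<beta> p * F p y) * dF w + (\<beta> p * dF w + d\<beta> w * F p y) * F p y))"
      unfolding d
      by (intro frechet_derivative_eqI has_derivative_diff has_derivative_add has_derivative_mult
         has_derivative_mult_right has)
    ultimately show ?thesis by (simp add: fun_eq_iff algebra_simps)
  qed
  have I2: "dg y y w + d\<omega> y w * F p y + \<omega> p w * dF y =
     (d\<beta> y * F p y + \<beta> p * dF y - d\<omega> y y) * F1 p y w + (\<beta> p * F p y - \<omega> p y) * dF1 y w" for w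
  proof -
    have "dir_deriv (\<lambda>q. g q y w + \<omega> q w * F q y) p =
        dir_deriv (\<lambda>q. (\<beta> q * F q y - \<omega> q y) * F1 q y w) p"
      by (rule frechet_derivative_cong_open[OF open_V p]) (rule F_null(2)[OF _ y])
    moreover have "dir_deriv (\<lambda>q. g q y w + \<omega> q w * F q y) p =
        (\<lambda>u. dg u y w + (\<omega> p w * dF u + d\<omega> u w * F p y))"
      unfolding d by (intro frechet_derivative_eqI has_derivative_add has_derivative_mult has)
    moreover have "dir_deriv (\<lambda>q. (\<beta> q * F q y - \<omega> q y) * F1 q y w) p =
        (\<lambda>u. (\<beta> p * F p y - \<omega> p y) * dF1 u w + ((\<beta> p * dF u + d\<beta> u * F p y) - d\<omega> u y) * F1 p y w)"
      unfolding d
      by (intro frechet_derivative_eqI has_derivative_diff has_derivative_mult has)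
    ultimately show ?thesis by (simp add: fun_eq_iff algebra_simps)
  qed
  have I3: "g p a w + \<omega> p w * dF y =
     (\<beta> p * dF y - \<omega> p a) * F1 p y w + (\<beta> p * F p y - \<omega> p y) * (dF1 y w - dF w)" for w
    using F_null(3)[OF p y, of a w] by (simp add: a1 a2)
  have E: "g p A w + \<omega> p A * \<sigma> + \<omega> p w * T - \<beta> p * T * \<sigma> =
    dg y y w + d\<omega> y y * \<sigma> + d\<omega> y w * F p y - d\<beta> y * F p y * \<sigma>
     - (dg w y y + 2 * d\<omega> w y * F p y - d\<beta> w * F p y * F p y) / 2" for w \<sigma>
    unfolding d by (rule L_christoffel[OF p A])
  have I1': "(dg w y y + 2 * d\<omega> w y * F p y - d\<beta> w * F p y * F p y) / 2 =
      \<beta> p * F p y * dF w - \<omega> p y * dF w" for w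
    using I1[of w] by (simp add: field_simps)
  have E1: "\<omega> p A - \<beta> p * T = d\<omega> y y - d\<beta> y * F p y"
    using E[of 0 0] E[of 0 1] by simp
  have K: "(d\<beta> y * F p y - d\<omega> y y + \<omega> p a) * F1 p y w = \<nu> * (g p y w + \<omega> p w * F p y)" for w
    unfolding \<nu>[symmetric] F_null(2)[OF p y] by simp
  have E2: "g p A w - g p a w - \<nu> * g p y w + \<omega> p w * (T - \<nu> * F p y) = 0" for w
    using E[of w 0] I2[of w] I3[of w] K[of w] unfolding I1' by (simp add: algebra_simps)
  \<comment> \<open>By \<open>E1\<close> and \<open>E2\<close> this vector is orthogonal to everything.\<close>
  have "(A - a - \<nu> *\<^sub>R y, T - \<nu> * F p y) = 0"
  proof (rule L_nondegenerate[OF p, of t])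
    fix w :: "'e \<times> real"
    obtain v \<sigma> where w: "w = (v, \<sigma>)" by fastforce
    have "\<omega> p A - \<omega> p a - \<nu> * \<omega> p y - \<beta> p * (T - \<nu> * F p y) = 0"
      using E1 \<nu> by (simp add: algebra_simps)
    then have "(\<omega> p A - \<omega> p a - \<nu> * \<omega> p y - \<beta> p * (T - \<nu> * F p y)) * \<sigma> = 0" by simp
    moreover have e1: "g p (A - a - \<nu> *\<^sub>R y) v = g p A v - g p a v - \<nu> * g p y v"
      using g_bilinear[OF p] by (simp add: bilinear_lsub bilinear_lmul)
    moreover have e2: "\<omega> p (A - a - \<nu> *\<^sub>R y) = \<omega> p A - \<omega> p a - \<nu> * \<omega> p y"
      using \<omega>_linear[OF p] by (simp add: linear_diff linear_scale)
    ultimately show "L (p, t) (A - a - \<nu> *\<^sub>R y, T - \<nu> * F p y) w = 0"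
      unfolding L_def w prod.case e1 e2 using E2[of v] by (simp add: algebra_simps)
  qed
  then have "A = a + \<nu> *\<^sub>R y" by (simp add: zero_prod_def algebra_simps)
  then show ?thesis using A a_def by auto
qed

text \<open>
  The Christoffel vector of the spacetime along a future-pointing null vector differs from that of
  the Fermat metric by a multiple of \<open>y\<close>, which \<open>d f\<close> does not see.
\<close>

lemma hessian_future_null:
  assumes p: "p \<in> V" and y: "y \<noteq> 0"
    and U: "open U" "p \<in> U" and f: "\<And>q. q \<in> U \<Longrightarrow> f differentiable (at q)"
    and f2: "\<And>v. (\<lambda>q. dir_deriv f q v) differentiable (at p)"
    and tangent: "dir_deriv f p y = 0"
  shows "covariant_hessian (\<lambda>(q, s). f q) (christoffel L (p, t)) (p, t) (y, F p y) (y, F p y) =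
    covariant_hessian f (chern_connection F p y) p y y"
proof -
  obtain \<nu> where \<nu>: "fst (christoffel L (p, t) (y, F p y) (y, F p y)) =
      chern_connection F p y y y + \<nu> *\<^sub>R y"
    using christoffel_L_eq_chern_connection[OF p y] by blast
  have "linear (dir_deriv f p)" using f U(2) linear_frechet_derivative by blast
  then have "dir_deriv f p (chern_connection F p y y y + \<nu> *\<^sub>R y) =
      dir_deriv f p (chern_connection F p y y y)"
    using tangent by (simp add: linear_add linear_scale)
  then show ?thesis
    using covariant_hessian_fst[OF U f, of "(y, F p y)" "christoffel L (p, t)" t "(y, F p y)"] f2
    by (simp add: \<nu> covariant_hessian_def)
qed

lemma hessian_uminus:
  assumes p: "p \<in> V"
    and U: "open U" "p \<in> U" and f: "\<And>q. q \<in> U \<Longrightarrow> f differentiable (at q)"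
    and f2: "\<And>v. (\<lambda>q. dir_deriv f q v) differentiable (at p)"
  shows "covariant_hessian (\<lambda>(q, s). f q) (christoffel L (p, t)) (p, t) (- u) (- u) =
    covariant_hessian (\<lambda>(q, s). f q) (christoffel L (p, t)) (p, t) u u"
proof -
  have "christoffel L (p, t) (- u) (- u) = christoffel L (p, t) u u"
    by (rule christoffel_uminus[of "V \<times> UNIV"])
      (use p open_V in \<open>auto intro: open_Times L_bilinear L_diff\<close>)
  moreover have "dir_deriv (\<lambda>q. dir_deriv f q (- v)) p (- v) = dir_deriv (\<lambda>q. dir_deriv f q v) p v" for v
  proof -
    have "dir_deriv (\<lambda>q. dir_deriv f q (- v)) p = dir_deriv (\<lambda>q. - dir_deriv f q v) p"
      by (rule frechet_derivative_cong_open[OF U]) (simp add: f linear_frechet_derivative linear_neg)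
    then show ?thesis
      using linear_frechet_derivative[OF f2] by (simp add: dir_deriv_minus f2 linear_neg)
  qed
  ultimately show ?thesis
    using covariant_hessian_fst[OF U f f2, of "christoffel L (p, t)" t] by simp
qed

text \<open>A nonzero null vector is future-pointing or the negative of a future-pointing one.\<close>

lemma null_cases:
  assumes p: "p \<in> V" and 0: "g p u u + 2 * \<omega> p u * \<tau> - \<beta> p * \<tau>\<^sup>2 = 0"
  shows "\<tau> = F p u \<or> - \<tau> = F p (- u)"
proof -
  have b: "\<beta> p > 0" by (rule \<beta>_pos[OF p])
  have neg: "\<omega> p (- u) = - \<omega> p u" "S p (- u) = S p u"
    using \<omega>_linear[OF p] r_bilinear[OF p]
    by (simp_all add: linear_neg S_def bilinear_lneg bilinear_rneg)
  have "r p u u = (\<beta> p * \<tau> - \<omega> p u)\<^sup>2 + \<beta> p * (g p u u + 2 * \<omega> p u * \<tau> - \<beta> p * \<tau>\<^sup>2)"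
    by (simp add: r_def power2_eq_square algebra_simps)
  then have "S p u = \<bar>\<beta> p * \<tau> - \<omega> p u\<bar>" by (simp add: 0 S_def)
  then have "\<beta> p * \<tau> = S p u + \<omega> p u \<or> - (\<beta> p * \<tau>) = S p u - \<omega> p u" by linarith
  then show ?thesis
    unfolding F_eq[OF p] neg using b by (auto simp: field_simps)
qed

lemma F_is_null:
  assumes "p \<in> V"
  shows "g p u u + 2 * \<omega> p u * F p u - \<beta> p * (F p u)\<^sup>2 = 0"
proof (cases "u = 0")
  case True
  have "g p 0 0 = 0" "\<omega> p 0 = 0"
    using g_bilinear[OF assms] \<omega>_linear[OF assms] by (simp_all add: bilinear_rzero linear_0)
  then show ?thesis by (simp add: True F_def)
next
  case False
  then show ?thesis using F_null(1)[OF assms] by (simp add: power2_eq_square)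
qed

end


section \<open>Charts and tangent vectors\<close>

lemma chart_inv_left: "is_chart c \<Longrightarrow> x \<in> fst c \<Longrightarrow> chart_inv c (snd c x) = x"
  by (auto simp: is_chart_def homeomorphism_def)

lemma chart_image_Int_open:
  assumes "is_chart c" "open U"
  shows "open (snd c ` (fst c \<inter> U))"
proof -
  have "openin (top_of_set (chart_image c)) (snd c ` (fst c \<inter> U))"
    using assms
    by (intro homeomorphism_imp_open_map[where S = "fst c" and g = "chart_inv c"])
      (auto simp: is_chart_def openin_open)
  then show ?thesis using assms(1) openin_open_trans is_chart_def by blast
qed

lemma Ck_on_Suc_differentiable: "Ck_on (Suc k) U f \<Longrightarrow> p \<in> U \<Longrightarrow> f differentiable (at p)"
  by simp

lemma charts_atD:
  assumes "smooth_atlas A" "c \<in> charts_at A x"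
  shows "c \<in> A" "x \<in> fst c" "is_chart c" "snd c x \<in> chart_image c" "chart_inv c (snd c x) = x"
  using assms chart_inv_left[of c x] by (auto simp: charts_at_def smooth_atlas_def chart_image_def)

lemma transition_differentiable:
  assumes "smooth_atlas A" "c \<in> charts_at A x" "d \<in> charts_at A x"
  shows "(snd d \<circ> chart_inv c) differentiable (at (snd c x))"
proof -
  have "Ck_transition (Suc 0) c d" using assms by (auto simp: smooth_atlas_def charts_at_def)
  then show ?thesis
    unfolding Ck_transition_def
    by (rule Ck_on_Suc_differentiable) (use assms in \<open>auto simp: charts_at_def\<close>)
qed

lemma tangent_of_zero:
  assumes "smooth_atlas A" "c \<in> charts_at A x"
  shows "tangent_of A c x 0 = zero_tangent"
  using linear_0[OF linear_frechet_derivative[OF transition_differentiable[OF assms]]]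
  by (auto simp: tangent_of_def fun_eq_iff)

lemma tangent_of_component:
  assumes "y \<in> tangent_space A x" "c \<in> charts_at A x"
  shows "tangent_of A c x (y c) = y"
proof
  fix d
  have "y d = dir_deriv (snd d \<circ> chart_inv c) (snd c x) (y c)" if "d \<in> charts_at A x"
    using assms that unfolding tangent_space_def by blast
  moreover have "y d = 0" if "d \<notin> charts_at A x"
    using assms that unfolding tangent_space_def by blast
  ultimately show "tangent_of A c x (y c) d = y d"
    by (simp add: tangent_of_def)
qed

lemma tangent_component_nonzero:
  assumes "smooth_atlas A" "y \<in> tangent_space A x" "c \<in> charts_at A x" "y \<noteq> zero_tangent"
  shows "y c \<noteq> 0"
  using assms tangent_of_zero tangent_of_component by metis

text \<open>Reverse the curve.\<close>

lemma uminus_boundary_tangent: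
  assumes A: "smooth_atlas A" and y: "y \<in> boundary_tangent_space A D x"
  shows "(\<lambda>c. - y c) \<in> boundary_tangent_space A D x"
proof -
  from y obtain c \<gamma> and \<epsilon> :: real where yT: "y \<in> tangent_space A x" and c: "c \<in> charts_at A x"
    and \<epsilon>: "\<epsilon> > 0" and \<gamma>: "\<gamma> 0 = x" "\<gamma> ` {-\<epsilon><..<\<epsilon>} \<subseteq> frontier D \<inter> fst c"
    and C1: "(snd c \<circ> \<gamma>) C1_differentiable_on {-\<epsilon><..<\<epsilon>}"
    and v: "((snd c \<circ> \<gamma>) has_vector_derivative y c) (at 0)"
    unfolding boundary_tangent_space_def by blast
  have "- y e = dir_deriv (snd e \<circ> chart_inv d) (snd d x) (- y d)"
    if "d \<in> charts_at A x" "e \<in> charts_at A x" for d e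
  proof -
    have "y e = dir_deriv (snd e \<circ> chart_inv d) (snd d x) (y d)"
      using yT that unfolding tangent_space_def by blast
    then show ?thesis
      by (simp add: linear_neg[OF linear_frechet_derivative[OF transition_differentiable[OF A that]]])
  qed
  moreover have "- y e = 0" if "e \<notin> charts_at A x" for e
    using yT that unfolding tangent_space_def neg_equal_0_iff_equal by blast
  ultimately have "(\<lambda>c. - y c) \<in> tangent_space A x"
    unfolding tangent_space_def by blast
  moreover have rev: "((snd c \<circ> (\<lambda>s. \<gamma> (- s))) has_vector_derivative - v) (at s)"
    if "((snd c \<circ> \<gamma>) has_vector_derivative v) (at (- s))" for v s
  proof -
    have "((\<lambda>s. - s) has_vector_derivative (-1::real)) (at s)"
      by (auto intro!: derivative_eq_intros)
    from vector_diff_chain_at[OF this that] show ?thesis by (simp add: o_def)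
  qed
  moreover have "(snd c \<circ> (\<lambda>s. \<gamma> (- s))) C1_differentiable_on {-\<epsilon><..<\<epsilon>}"
  proof -
    obtain E where E: "\<And>s. s \<in> {-\<epsilon><..<\<epsilon>} \<Longrightarrow> ((snd c \<circ> \<gamma>) has_vector_derivative E s) (at s)"
      and cont: "continuous_on {-\<epsilon><..<\<epsilon>} E"
      using C1 unfolding C1_differentiable_on_def by blast
    have "continuous_on {-\<epsilon><..<\<epsilon>} (\<lambda>s. - E (- s))"
      by (intro continuous_on_minus continuous_on_compose2[OF cont]) (auto intro!: continuous_intros)
    then show ?thesis
      unfolding C1_differentiable_on_def using rev[OF E] by (intro exI[of _ "\<lambda>s. - E (- s)"]) auto
  qed
  moreover have "(\<lambda>s. \<gamma> (- s)) ` {-\<epsilon><..<\<epsilon>} \<subseteq> frontier D \<inter> fst c"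
    using \<gamma>(2) by (fastforce simp: image_subset_iff)
  ultimately show ?thesis
    unfolding boundary_tangent_space_def
    using c \<epsilon> \<gamma>(1) v rev[of "y c" 0]
    by (intro CollectI conjI bexI[of _ c] exI[of _ "\<lambda>s. \<gamma> (- s)"] exI[of _ \<epsilon>]) auto
qed

lemma defining_function_C2:
  assumes A: "smooth_atlas A" and f: "defining_function_near A D x f" and c: "c \<in> charts_at A x"
  obtains U where "open U" "snd c x \<in> U"
    and "\<And>q. q \<in> U \<Longrightarrow> (f \<circ> chart_inv c) differentiable (at q)"
    and "\<And>v. (\<lambda>q. dir_deriv (f \<circ> chart_inv c) q v) differentiable (at (snd c x))"
proof -
  obtain U where U: "open U" "x \<in> U" "Ck_function A 2 U f"
    using f unfolding defining_function_near_def by blast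
  note c' = charts_atD[OF A c]
  show ?thesis
  proof (rule that[of "snd c ` (fst c \<inter> U)"])
    show "open (snd c ` (fst c \<inter> U))" by (rule chart_image_Int_open[OF c'(3) U(1)])
    show x: "snd c x \<in> snd c ` (fst c \<inter> U)" using c' U by blast
    have C2: "Ck_on (Suc (Suc 0)) (snd c ` (fst c \<inter> U)) (f \<circ> chart_inv c)"
      using U(3) c'(1) by (simp add: Ck_function_def numeral_2_eq_2)
    then show "(f \<circ> chart_inv c) differentiable (at q)" if "q \<in> snd c ` (fst c \<inter> U)" for q
      using that by (rule Ck_on_Suc_differentiable)
    have "Ck_on (Suc 0) (snd c ` (fst c \<inter> U)) (\<lambda>q. dir_deriv (f \<circ> chart_inv c) q v)" for v
      using C2 unfolding Ck_on.simps(2)[of "Suc 0"] by blast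
    then show "(\<lambda>q. dir_deriv (f \<circ> chart_inv c) q v) differentiable (at (snd c x))" for v
      using x by (rule Ck_on_Suc_differentiable)
  qed
qed

text \<open>
  A tangent vector of the boundary is represented by a curve in one chart \<open>d\<close> only, so the chain rule
  passes through the transition from \<open>d\<close> to the given chart \<open>c\<close>.
\<close>

lemma defining_function_boundary_deriv:
  assumes A: "smooth_atlas A" and f: "defining_function_near A D x f" and c: "c \<in> charts_at A x"
    and y: "y \<in> boundary_tangent_space A D x"
  shows "dir_deriv (f \<circ> chart_inv c) (snd c x) (y c) = 0"
proof -
  from y obtain d \<gamma> and \<epsilon> :: real where yT: "y \<in> tangent_space A x" and d: "d \<in> charts_at A x"
    and \<epsilon>: "\<epsilon> > 0" and \<gamma>: "\<gamma> 0 = x" "\<gamma> ` {-\<epsilon><..<\<epsilon>} \<subseteq> frontier D \<inter> fst d"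
    and v: "((snd d \<circ> \<gamma>) has_vector_derivative y d) (at 0)"
    unfolding boundary_tangent_space_def by blast
  obtain U where U: "open U" "x \<in> U" "\<And>q. q \<in> U \<Longrightarrow> f q = 0 \<longleftrightarrow> q \<in> frontier D"
    using f unfolding defining_function_near_def by blast
  note c' = charts_atD[OF A c] and d' = charts_atD[OF A d]
  define W where "W = snd d ` (fst d \<inter> (fst c \<inter> U))"
  have W: "open W" "(snd d \<circ> \<gamma>) 0 \<in> W"
    using c' d' U \<gamma>(1) unfolding W_def
    by (auto intro!: chart_image_Int_open open_Int simp: is_chart_def)
  have "isCont (snd d \<circ> \<gamma>) 0" using v by (rule has_vector_derivative_continuous)
  then have "\<forall>\<^sub>F s in at 0. (snd d \<circ> \<gamma>) s \<in> W"
    using W topological_tendstoD unfolding isCont_def by blast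
  moreover have "\<forall>\<^sub>F s in at 0. s \<in> {-\<epsilon><..<\<epsilon>}"
    using \<epsilon> by (intro eventually_at_in_open') auto
  ultimately have ev: "\<forall>\<^sub>F s in at 0. f (chart_inv c (snd c (chart_inv d (snd d (\<gamma> s))))) = 0"
  proof eventually_elim
    case (elim s)
    then obtain z where z: "z \<in> fst d" "z \<in> fst c" "z \<in> U" "snd d (\<gamma> s) = snd d z"
      by (auto simp: W_def)
    have \<gamma>s: "\<gamma> s \<in> fst d" "\<gamma> s \<in> frontier D" using elim(2) \<gamma>(2) by auto
    then have "\<gamma> s = z" using z d'(3) chart_inv_left by metis
    then show ?case
      using \<gamma>s z chart_inv_left[OF c'(3)] chart_inv_left[OF d'(3)] U(3) by simp
  qed
  obtain V where V: "snd c x \<in> V" "\<And>q. q \<in> V \<Longrightarrow> (f \<circ> chart_inv c) differentiable (at q)"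
    using defining_function_C2[OF A f c] by metis
  have 1: "((snd d \<circ> \<gamma>) has_derivative (\<lambda>s. s *\<^sub>R y d)) (at 0)"
    using v by (simp add: has_vector_derivative_def)
  have 2: "((snd c \<circ> chart_inv d) has_derivative dir_deriv (snd c \<circ> chart_inv d) (snd d x))
      (at ((snd d \<circ> \<gamma>) 0))"
    using dir_deriv_works[OF transition_differentiable[OF A d c]] \<gamma>(1) by simp
  have 3: "((f \<circ> chart_inv c) has_derivative dir_deriv (f \<circ> chart_inv c) (snd c x))
      (at ((snd c \<circ> chart_inv d) ((snd d \<circ> \<gamma>) 0)))"
    using dir_deriv_works[OF V(2)[OF V(1)]] \<gamma>(1) d' by simp
  have "((\<lambda>s. f (chart_inv c (snd c (chart_inv d (snd d (\<gamma> s)))))) has_derivative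
     (\<lambda>s. dir_deriv (f \<circ> chart_inv c) (snd c x) (dir_deriv (snd c \<circ> chart_inv d) (snd d x) (s *\<^sub>R y d)))) (at 0)"
    using has_derivative_compose[OF has_derivative_compose[OF 1 2] 3] by (simp add: o_def)
  moreover have "f (chart_inv c (snd c (chart_inv d (snd d (\<gamma> 0))))) = 0"
  proof -
    have "\<gamma> 0 \<in> \<gamma> ` {-\<epsilon><..<\<epsilon>}" using \<epsilon> by (intro imageI) auto
    then have "x \<in> frontier D" using \<gamma> by auto
    then show ?thesis using U c' d' \<gamma>(1) by simp
  qed
  ultimately have "((\<lambda>s. 0) has_derivative
     (\<lambda>s. dir_deriv (f \<circ> chart_inv c) (snd c x) (dir_deriv (snd c \<circ> chart_inv d) (snd d x) (s *\<^sub>R y d)))) (at (0::real))"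
    using ev by (auto intro: has_derivative_transform_eventually)
  then have "(\<lambda>s. dir_deriv (f \<circ> chart_inv c) (snd c x)
       (dir_deriv (snd c \<circ> chart_inv d) (snd d x) (s *\<^sub>R y d))) = (\<lambda>s::real. 0)"
    using has_derivative_const has_derivative_unique by blast
  from fun_cong[OF this, of 1]
  have "dir_deriv (f \<circ> chart_inv c) (snd c x) (dir_deriv (snd c \<circ> chart_inv d) (snd d x) (y d)) = 0"
    by simp
  moreover have "y c = dir_deriv (snd c \<circ> chart_inv d) (snd d x) (y d)"
    using yT c d unfolding tangent_space_def by blast
  ultimately show ?thesis by simp
qed


section \<open>Comparison of the two Hessians\<close>

lemma stationary_coordinates_chart:
  assumes data: "stationary_data A g0 w0 b" and c: "c \<in> A"
  shows "stationary_coordinates (chart_image c) (metric_coord A g0 c) (tangent_fun_coord A w0 c)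
    (b \<circ> chart_inv c)"
proof -
  have A: "smooth_atlas A" and g: "riemannian_metric A g0" and w: "smooth_one_form A w0"
    and b: "Ck_function A (Suc 0) UNIV b" "\<And>x. b x > 0"
    using data unfolding stationary_data_def by blast+
  have g': "Ck_on (Suc 0) (chart_image c) (\<lambda>p. metric_coord A g0 c p u v)" for u v
    using g c unfolding riemannian_metric_def by blast
  have w': "Ck_on (Suc 0) (chart_image c) (\<lambda>p. tangent_fun_coord A w0 c p u)" for u
    using w c unfolding smooth_one_form_def by blast
  have b': "Ck_on (Suc 0) (chart_image c) (b \<circ> chart_inv c)"
    using b(1) c unfolding Ck_function_def chart_image_def by (metis Int_UNIV_right)
  show ?thesis
  proof (rule stationary_coordinates.intro)
    show "open (chart_image c)" using A c by (auto simp: smooth_atlas_def is_chart_def)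
  qed (use g w b(2) c Ck_on_Suc_differentiable[OF g'] Ck_on_Suc_differentiable[OF w']
      Ck_on_Suc_differentiable[OF b'] in \<open>auto simp: riemannian_metric_def smooth_one_form_def\<close>)
qed

lemma stationary_metric_in_coordinates:
  "stationary_metric_coord A (stationary_metric g0 w0 b) c =
    stationary_coordinates.L (metric_coord A g0 c) (tangent_fun_coord A w0 c) (b \<circ> chart_inv c)"
  if "stationary_coordinates (chart_image c) (metric_coord A g0 c) (tangent_fun_coord A w0 c) (b \<circ> chart_inv c)"
  using stationary_coordinates.L_def[OF that]
  by (simp add: stationary_metric_coord_def stationary_metric_def Let_def metric_coord_def
      tangent_fun_coord_def fun_eq_iff)

lemma fermat_metric_in_coordinates:
  "tangent_fun_coord A (fermat_metric g0 w0 b) c =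
    stationary_coordinates.F (metric_coord A g0 c) (tangent_fun_coord A w0 c) (b \<circ> chart_inv c)"
  if "stationary_coordinates (chart_image c) (metric_coord A g0 c) (tangent_fun_coord A w0 c) (b \<circ> chart_inv c)"
  using stationary_coordinates.F_def[OF that]
  by (simp add: fermat_metric_def Let_def metric_coord_def tangent_fun_coord_def fun_eq_iff)

lemma coord_at:
  assumes "smooth_atlas A" "c \<in> charts_at A x" "y \<in> tangent_space A x"
  shows "metric_coord A g c (snd c x) (y c) (y c) = g x y y"
    and "tangent_fun_coord A w c (snd c x) (y c) = w x y"
  using charts_atD(5)[OF assms(1,2)] tangent_of_component[OF assms(3,2)]
  by (simp_all add: metric_coord_def tangent_fun_coord_def)

lemma lightlike_fermat:
  assumes data: "stationary_data A g0 w0 b" and y: "y \<in> tangent_space A x" "y \<noteq> zero_tangent"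
    and c: "c \<in> charts_at A x"
  shows "lightlike (stationary_metric g0 w0 b) (x, t) (y, fermat_metric g0 w0 b x y)"
proof -
  have A: "smooth_atlas A" using data by (simp add: stationary_data_def)
  interpret C: stationary_coordinates "chart_image c" "metric_coord A g0 c" "tangent_fun_coord A w0 c"
      "b \<circ> chart_inv c"
    by (rule stationary_coordinates_chart[OF data charts_atD(1)[OF A c]])
  have "C.F (snd c x) (y c) = fermat_metric g0 w0 b x y"
    using coord_at(2)[OF A c y(1)] fermat_metric_in_coordinates[OF C.stationary_coordinates_axioms]
    by metis
  then show ?thesis
    using C.F_is_null[OF charts_atD(4)[OF A c], of "y c"] y(2)
    by (simp add: coord_at[OF A c y(1)] charts_atD(5)[OF A c] lightlike_def stationary_metric_def
        power2_eq_square mult.assoc)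
qed

lemma lightlike_cases:
  assumes data: "stationary_data A g0 w0 b" and y: "y \<in> tangent_space A x"
    and c: "c \<in> charts_at A x" and null: "lightlike (stationary_metric g0 w0 b) (x, t) (y, \<tau>)"
    and y': "(\<lambda>c. - y c) \<in> tangent_space A x"
  shows "y \<noteq> zero_tangent"
    and "\<tau> = fermat_metric g0 w0 b x y \<or> - \<tau> = fermat_metric g0 w0 b x (\<lambda>c. - y c)"
proof -
  have A: "smooth_atlas A" using data by (simp add: stationary_data_def)
  interpret C: stationary_coordinates "chart_image c" "metric_coord A g0 c" "tangent_fun_coord A w0 c"
      "b \<circ> chart_inv c"
    by (rule stationary_coordinates_chart[OF data charts_atD(1)[OF A c]])
  note p = charts_atD(4)[OF A c]
  have F: "C.F (snd c x) (y c) = fermat_metric g0 w0 b x y"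
    "C.F (snd c x) (- y c) = fermat_metric g0 w0 b x (\<lambda>c. - y c)"
    using coord_at(2)[OF A c y] coord_at(2)[OF A c y']
      fermat_metric_in_coordinates[OF C.stationary_coordinates_axioms]
    by metis+
  have eq: "metric_coord A g0 c (snd c x) (y c) (y c) + 2 * tangent_fun_coord A w0 c (snd c x) (y c) * \<tau>
      - (b \<circ> chart_inv c) (snd c x) * \<tau>\<^sup>2 = 0"
    using null by (simp add: coord_at[OF A c y] charts_atD(5)[OF A c] lightlike_def stationary_metric_def
        power2_eq_square algebra_simps)
  from C.null_cases[OF p this]
  show "\<tau> = fermat_metric g0 w0 b x y \<or> - \<tau> = fermat_metric g0 w0 b x (\<lambda>c. - y c)"
    by (simp add: F)
  show "y \<noteq> zero_tangent"
  proof
    assume 0: "y = zero_tangent"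
    have "metric_coord A g0 c (snd c x) 0 0 = 0" "tangent_fun_coord A w0 c (snd c x) 0 = 0"
      using C.g_bilinear[OF p] C.\<omega>_linear[OF p] by (simp_all add: bilinear_rzero linear_0)
    then have "\<tau> = 0" using eq C.\<beta>_pos[OF p] by (simp add: 0)
    then show False using null 0 by (simp add: lightlike_def)
  qed
qed

lemma levi_civita_hessian_future_null:
  assumes data: "stationary_data A g0 w0 b" and f: "defining_function_near A D x f"
    and y: "y \<in> boundary_tangent_space A D x" "y \<noteq> zero_tangent" and c: "c \<in> charts_at A x"
    and \<tau>: "\<tau> = fermat_metric g0 w0 b x y"
  shows "levi_civita_hessian A (stationary_metric g0 w0 b) (\<lambda>(q, s). f q) c (x, t) (y, \<tau>) (y, \<tau>) =
    finsler_hessian A (fermat_metric g0 w0 b) f c x y y y"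
proof -
  have A: "smooth_atlas A" using data by (simp add: stationary_data_def)
  interpret C: stationary_coordinates "chart_image c" "metric_coord A g0 c" "tangent_fun_coord A w0 c"
      "b \<circ> chart_inv c"
    by (rule stationary_coordinates_chart[OF data charts_atD(1)[OF A c]])
  have yT: "y \<in> tangent_space A x" using y by (simp add: boundary_tangent_space_def)
  note F = fermat_metric_in_coordinates[OF C.stationary_coordinates_axioms]
    and L = stationary_metric_in_coordinates[OF C.stationary_coordinates_axioms]
  have \<tau>: "\<tau> = C.F (snd c x) (y c)"
    using coord_at(2)[OF A c yT] F \<tau> by metis
  obtain U where U: "open U" "snd c x \<in> U"
    "\<And>q. q \<in> U \<Longrightarrow> (f \<circ> chart_inv c) differentiable (at q)"
    "\<And>v. (\<lambda>q. dir_deriv (f \<circ> chart_inv c) q v) differentiable (at (snd c x))"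
    using defining_function_C2[OF A f c] by metis
  show ?thesis
    using C.hessian_future_null[OF charts_atD(4)[OF A c] tangent_component_nonzero[OF A yT c y(2)] U
        defining_function_boundary_deriv[OF A f c y(1)], of t]
    by (simp add: levi_civita_hessian_def finsler_hessian_def F L \<tau>)
qed

lemma levi_civita_hessian_uminus:
  assumes data: "stationary_data A g0 w0 b" and f: "defining_function_near A D x f"
    and c: "c \<in> charts_at A x"
  shows "levi_civita_hessian A (stationary_metric g0 w0 b) (\<lambda>(q, s). f q) c (x, t)
      (\<lambda>c. - y c, - \<tau>) (\<lambda>c. - y c, - \<tau>) =
    levi_civita_hessian A (stationary_metric g0 w0 b) (\<lambda>(q, s). f q) c (x, t) (y, \<tau>) (y, \<tau>)"
proof -
  have A: "smooth_atlas A" using data by (simp add: stationary_data_def)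
  interpret C: stationary_coordinates "chart_image c" "metric_coord A g0 c" "tangent_fun_coord A w0 c"
      "b \<circ> chart_inv c"
    by (rule stationary_coordinates_chart[OF data charts_atD(1)[OF A c]])
  note L = stationary_metric_in_coordinates[OF C.stationary_coordinates_axioms]
  obtain U where U: "open U" "snd c x \<in> U"
    "\<And>q. q \<in> U \<Longrightarrow> (f \<circ> chart_inv c) differentiable (at q)"
    "\<And>v. (\<lambda>q. dir_deriv (f \<circ> chart_inv c) q v) differentiable (at (snd c x))"
    using defining_function_C2[OF A f c] by metis
  show ?thesis
    using C.hessian_uminus[OF charts_atD(4)[OF A c] U, of t "(y c, \<tau>)"]
    by (simp add: levi_civita_hessian_def L)
qed

text \<open>
  The weak equivalence is the case where \<open>P\<close> is nonpositivity, the strong one the case where it is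
  negativity; any \<open>P\<close> works because both sides test \<open>P\<close> on the same numbers.
\<close>

lemma hessian_sign_condition_iff:
  assumes data: "stationary_data A g0 w0 b"
    and \<phi>: "\<forall>x\<in>frontier D. defining_function_near A D x (\<phi> x)"
  shows "(\<forall>x\<in>frontier D. \<forall>y\<in>boundary_tangent_space A D x - {zero_tangent}. \<forall>c\<in>charts_at A x.
        P (finsler_hessian A (fermat_metric g0 w0 b) (\<phi> x) c x y y y)) \<longleftrightarrow>
    (\<forall>x\<in>frontier D. \<forall>t. \<forall>v\<in>boundary_tangent_space A D x \<times> UNIV.
        lightlike (stationary_metric g0 w0 b) (x, t) v \<longrightarrow> (\<forall>c\<in>charts_at A x.
          P (levi_civita_hessian A (stationary_metric g0 w0 b) (\<lambda>(q, s). \<phi> x q) c (x, t) v v)))"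
    (is "?Fermat \<longleftrightarrow> ?light")
proof
  have A: "smooth_atlas A" using data by (simp add: stationary_data_def)
  have sub: "y \<in> tangent_space A x" if "y \<in> boundary_tangent_space A D x" for x y
    using that by (simp add: boundary_tangent_space_def)
  assume Fermat: ?Fermat
  show ?light
  proof (intro ballI allI impI)
    fix x t v c
    assume x: "x \<in> frontier D" and v: "v \<in> boundary_tangent_space A D x \<times> UNIV"
      and null: "lightlike (stationary_metric g0 w0 b) (x, t) v" and c: "c \<in> charts_at A x"
    obtain y \<tau> where v_eq: "v = (y, \<tau>)" and y: "y \<in> boundary_tangent_space A D x" using v by blast
    note y' = uminus_boundary_tangent[OF A y] and f = \<phi>[rule_format, OF x]
    note cases = lightlike_cases[OF data sub[OF y] c null[unfolded v_eq] sub[OF y']]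
    then have y0: "(\<lambda>c. - y c) \<noteq> zero_tangent" by (auto simp: fun_eq_iff)
    from cases(2) show "P (levi_civita_hessian A (stationary_metric g0 w0 b) (\<lambda>(q, s). \<phi> x q) c (x, t) v v)"
    proof
      assume "\<tau> = fermat_metric g0 w0 b x y"
      then show ?thesis
        using levi_civita_hessian_future_null[OF data f y cases(1) c] Fermat x y cases(1) c
        by (simp add: v_eq)
    next
      have past: "P (finsler_hessian A (fermat_metric g0 w0 b) (\<phi> x) c x
          (\<lambda>c. - y c) (\<lambda>c. - y c) (\<lambda>c. - y c))"
        using Fermat x y' y0 c by blast
      assume "- \<tau> = fermat_metric g0 w0 b x (\<lambda>c. - y c)"
      then show ?thesis
        using levi_civita_hessian_future_null[OF data f y' y0 c, of "- \<tau>" t]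
          levi_civita_hessian_uminus[OF data f c, of t y \<tau>] past
        by (simp add: v_eq)
    qed
  qed
next
  assume light: ?light
  show ?Fermat
  proof (intro ballI)
    fix x y c
    assume x: "x \<in> frontier D" and "y \<in> boundary_tangent_space A D x - {zero_tangent}"
      and c: "c \<in> charts_at A x"
    then have y: "y \<in> boundary_tangent_space A D x" "y \<noteq> zero_tangent" by auto
    then have "lightlike (stationary_metric g0 w0 b) (x, 0) (y, fermat_metric g0 w0 b x y)"
      using lightlike_fermat[OF data _ _ c] by (auto simp: boundary_tangent_space_def)
    with light x y c
    have "P (levi_civita_hessian A (stationary_metric g0 w0 b) (\<lambda>(q, s). \<phi> x q) c (x, 0)
        (y, fermat_metric g0 w0 b x y) (y, fermat_metric g0 w0 b x y))"
      by blast
    then show "P (finsler_hessian A (fermat_metric g0 w0 b) (\<phi> x) c x y y y)"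
      using levi_civita_hessian_future_null[OF data \<phi>[rule_format, OF x] y c refl] by simp
  qed
qed

theorem theorem3p4:
  fixes A :: "('a::{t2_space, second_countable_topology}, 'e::euclidean_space) chart set"
    and g0 :: "('a, 'e) metric"
    and w0 :: "('a, 'e) tangent_fun"
    and b :: "'a \<Rightarrow> real"
    and D :: "'a set"
    and \<phi> :: "'a \<Rightarrow> 'a \<Rightarrow> real"
  assumes "stationary_data A g0 w0 b"
    and "C2_domain A D"
    and "\<forall>x\<in>frontier D. defining_function_near A D x (\<phi> x)"
  shows "(infinitesimally_convex A D (fermat_metric g0 w0 b) \<phi> \<longleftrightarrow>
            infinitesimally_light_convex A D (stationary_metric g0 w0 b) \<phi>) \<and>
         (strongly_convex A D (fermat_metric g0 w0 b) \<phi> \<longleftrightarrow>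
            strongly_light_convex A D (stationary_metric g0 w0 b) \<phi>)"
  unfolding infinitesimally_convex_def infinitesimally_light_convex_def
    strongly_convex_def strongly_light_convex_def
  by (intro conjI hessian_sign_condition_iff assms(1,3))

end
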